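(* Let $\Bbbk$ be an algebraically closed field of characteristic zero and let $\mathbf f,\mathbf g\in\Bbbk[x,y]$ be two nonzero polynomials. Suppose that (a) $\phi:K\{\mathbf f\}\to K\{\mathbf g\}$ is a Poisson morphism, and (b) $\mathbf f=\prod_{i=1}^ml_i$ is a product of distinct linear forms, i.e. $l_i=a_ix+b_iy+c_i\notin\Bbbk$ with $a_i,b_i,c_i\in\Bbbk$ and $l_i\notin\Bbbk^\times l_j$ for $i\ne j$, such that for each $i$ there are at least three $j$ for which $l_i$ and $l_j$ generate the algebra $\Bbbk[x,y]$. Then the following hold. (1) $\phi(\mathbf f)\in\Bbbk[x,y]\,\mathbf g$ and $\deg\mathbf f\le\deg\mathbf g$. (2) If $\deg\mathbf f=\deg\mathbf g$, then $\phi$ preserves the degree. Consequently, $\phi$ is a $\Bbbk$-algebra isomorphism sending $x\mapsto c_{11}x+c_{12}y+c_1$ and $y\mapsto c_{21}x+c_{22}y+c_2$ for some $c_1,c_2\in\Bbbk$ and some $\begin{pmatrix}c_{11}&c_{12}\\c_{21}&c_{22}\end{pmatrix}\in GL_2(\Bbbk)$. Further, $\phi(\mathbf f)=(c_{11}c_{22}-c_{12}c_{21})\,\mathbf g$. (3) If $\mathbf f$ is homogeneous and $\deg\mathbf f=\deg\mathbf g$, then, up to an affine change of variables (in the target $K\{\mathbf g\}$), $\phi(x)$ and $\phi(y)$ are homogeneous of degree $1$, and in this setting (i.e. with respect to the new variables) $\mathbf g$ is also homogeneous. (4) $K\{\mathbf f\}$ has the Dixmier property.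
   Context: For $\mathbf f\in\Bbbk(x,y)$, $K\{\mathbf f\}$ denotes the rational function field $\Bbbk(x,y)$ equipped with the unique ($\Bbbk$-bilinear) Poisson bracket such that $\{x,y\}=\mathbf f$; explicitly $\{g,h\}=\left(\frac{\partial g}{\partial x}\frac{\partial h}{\partial y}-\frac{\partial g}{\partial y}\frac{\partial h}{\partial x}\right)\mathbf f$. A Poisson morphism is a $\Bbbk$-algebra homomorphism preserving Poisson brackets. $\deg$ is total degree in $x,y$. A Poisson field $K$ has the Dixmier property if every Poisson endomorphism of $K$ is an automorphism. *)

theory Defs
  imports "HOL-Computational_Algebra.Computational_Algebra"
begin

section \<open>Polynomials in two variables\<close>

text \<open>
  The ring \<open>k[x,y]\<close> is represented as \<open>k[x][y]\<close>: the inner polynomials are polynomials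
  in \<open>x\<close>, the outer variable is \<open>y\<close>.
\<close>

type_synonym 'k poly2 = "'k poly poly"

definition PX :: "'k::comm_ring_1 poly2" where "PX = [:[:0, 1:]:]"

definition PY :: "'k::comm_ring_1 poly2" where "PY = [:0, 1:]"

definition pconst :: "'k::comm_ring_1 \<Rightarrow> 'k poly2" where "pconst c = [:[:c:]:]"

text \<open>The coefficient of \<open>x^i y^j\<close>.\<close>

definition mcoeff :: "'k::comm_ring_1 poly2 \<Rightarrow> nat \<Rightarrow> nat \<Rightarrow> 'k"
  where "mcoeff p i j = coeff (coeff p j) i"

text \<open>The total degree, with the convention that the zero polynomial has degree 0.\<close>

definition total_degree :: "'k::comm_ring_1 poly2 \<Rightarrow> nat"
  where "total_degree p = Max (insert 0 {i + j |i j. mcoeff p i j \<noteq> 0})"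

definition homogeneous_of_degree :: "nat \<Rightarrow> 'k::comm_ring_1 poly2 \<Rightarrow> bool"
  where "homogeneous_of_degree d p \<longleftrightarrow> (\<forall>i j. mcoeff p i j \<noteq> 0 \<longrightarrow> i + j = d)"

definition homogeneous :: "'k::comm_ring_1 poly2 \<Rightarrow> bool"
  where "homogeneous p \<longleftrightarrow> (\<exists>d. homogeneous_of_degree d p)"

definition subst2 :: "'k::comm_ring_1 poly2 \<Rightarrow> 'k poly2 \<Rightarrow> 'k poly2 \<Rightarrow> 'k poly2"
  where "subst2 p u v =
    (\<Sum>j\<le>degree p. \<Sum>i\<le>degree (coeff p j). pconst (mcoeff p i j) * u ^ i * v ^ j)"

definition affine_form :: "'k::comm_ring_1 \<Rightarrow> 'k \<Rightarrow> 'k \<Rightarrow> 'k poly2"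
  where "affine_form a b c = pconst a * PX + pconst b * PY + pconst c"

text \<open>The pairs \<open>(u, v)\<close> of new variables obtained by an invertible affine change of variables.\<close>

definition affine_coordinates :: "'k::field poly2 \<Rightarrow> 'k poly2 \<Rightarrow> bool"
  where "affine_coordinates u v \<longleftrightarrow>
    (\<exists>a b c a' b' c'. a * b' - b * a' \<noteq> 0 \<and> u = affine_form a b c \<and> v = affine_form a' b' c')"

inductive_set generated_subalgebra :: "'k::comm_ring_1 poly2 set \<Rightarrow> 'k poly2 set"
  for S :: "'k poly2 set" where
  gen: "p \<in> S \<Longrightarrow> p \<in> generated_subalgebra S"
| const: "pconst c \<in> generated_subalgebra S"
| add: "p \<in> generated_subalgebra S \<Longrightarrow> q \<in> generated_subalgebra S \<Longrightarrow>
    p + q \<in> generated_subalgebra S"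
| mult: "p \<in> generated_subalgebra S \<Longrightarrow> q \<in> generated_subalgebra S \<Longrightarrow>
    p * q \<in> generated_subalgebra S"

lemma finite_mcoeff_support: "finite {(i, j). mcoeff p i j \<noteq> 0}"
proof (rule finite_subset)
  show "{(i, j). mcoeff p i j \<noteq> 0} \<subseteq> (\<Union>j\<in>{..degree p}. (\<lambda>i. (i, j)) ` {..degree (coeff p j)})"
  proof clarify
    fix i j assume *: "mcoeff p i j \<noteq> 0"
    then have "i \<le> degree (coeff p j)" by (auto simp: mcoeff_def intro: le_degree)
    moreover from * have "coeff p j \<noteq> 0" by (auto simp: mcoeff_def)
    then have "j \<le> degree p" by (rule le_degree)
    ultimately show "(i, j) \<in> (\<Union>j\<in>{..degree p}. (\<lambda>i. (i, j)) ` {..degree (coeff p j)})" by auto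
  qed
qed simp

lemma finite_total_degrees: "finite {i + j |i j. mcoeff p i j \<noteq> 0}"
proof -
  have "{i + j |i j. mcoeff p i j \<noteq> 0} = (\<lambda>(i, j). i + j) ` {(i, j). mcoeff p i j \<noteq> 0}"
    by auto
  then show ?thesis using finite_mcoeff_support[of p] by simp
qed

lemma le_total_degree: "mcoeff p i j \<noteq> 0 \<Longrightarrow> i + j \<le> total_degree p"
  unfolding total_degree_def using finite_total_degrees[of p] by (intro Max_ge) auto

lemma mcoeff_nonzero_exists:
  assumes "p \<noteq> 0" obtains i j where "mcoeff p i j \<noteq> 0"
  using assms unfolding mcoeff_def by (metis coeff_0 poly_eqI)

lemma total_degree_attained:
  assumes "p \<noteq> 0" obtains i j where "mcoeff p i j \<noteq> 0" "i + j = total_degree p"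
proof -
  let ?S = "{i + j |i j. mcoeff p i j \<noteq> 0}"
  obtain i j where "mcoeff p i j \<noteq> 0" by (rule mcoeff_nonzero_exists[OF assms])
  then have ne: "?S \<noteq> {}" by blast
  have "total_degree p = Max ?S"
    unfolding total_degree_def using Max_insert[OF finite_total_degrees ne] by simp
  moreover have "Max ?S \<in> ?S" using finite_total_degrees ne by (rule Max_in)
  ultimately show thesis using that by auto
qed

lemma mcoeff_mult:
  "mcoeff (p * q) i j = (\<Sum>b\<le>j. \<Sum>a\<le>i. mcoeff p a b * mcoeff q (i - a) (j - b))"
  by (simp add: mcoeff_def coeff_mult coeff_sum)

lemma top_monomial:
  assumes "p \<noteq> 0"
  obtains i j where "mcoeff p i j \<noteq> 0" "i + j = total_degree p"
    "\<And>i' j'. mcoeff p i' j' \<noteq> 0 \<Longrightarrow> i' + j' = total_degree p \<Longrightarrow> j' \<le> j"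
proof -
  let ?P = "\<lambda>j. \<exists>i. mcoeff p i j \<noteq> 0 \<and> i + j = total_degree p"
  have ex: "\<exists>j. ?P j" using total_degree_attained[OF assms] by metis
  have bd: "\<forall>j. ?P j \<longrightarrow> j \<le> total_degree p" by auto
  then have P: "?P (Greatest ?P)" using GreatestI_ex_nat[of ?P "total_degree p", OF ex] by blast
  show thesis using P that Greatest_le_nat[of ?P _ "total_degree p"] bd by blast
qed

lemma total_degree_mult:
  fixes p q :: "'k::idom poly2"
  assumes "p \<noteq> 0" "q \<noteq> 0"
  shows "total_degree (p * q) = total_degree p + total_degree q"
proof (rule antisym)
  obtain i j where "mcoeff (p * q) i j \<noteq> 0" and eq: "i + j = total_degree (p * q)"
    using total_degree_attained[of "p * q"] assms by auto
  then obtain b where "b \<le> j" and "(\<Sum>a\<le>i. mcoeff p a b * mcoeff q (i - a) (j - b)) \<noteq> 0"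
    unfolding mcoeff_mult by (meson atMost_iff sum.not_neutral_contains_not_neutral)
  then obtain a where "a \<le> i" "mcoeff p a b * mcoeff q (i - a) (j - b) \<noteq> 0"
    by (meson atMost_iff sum.not_neutral_contains_not_neutral)
  then show "total_degree (p * q) \<le> total_degree p + total_degree q"
    using le_total_degree[of p a b] le_total_degree[of q "i - a" "j - b"] eq \<open>b \<le> j\<close> by fastforce
next
  obtain i j where p: "mcoeff p i j \<noteq> 0" "i + j = total_degree p"
    "\<And>i' j'. mcoeff p i' j' \<noteq> 0 \<Longrightarrow> i' + j' = total_degree p \<Longrightarrow> j' \<le> j"
    using top_monomial[OF assms(1)] by metis
  obtain k l where q: "mcoeff q k l \<noteq> 0" "k + l = total_degree q"
    "\<And>i' j'. mcoeff q i' j' \<noteq> 0 \<Longrightarrow> i' + j' = total_degree q \<Longrightarrow> j' \<le> l"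
    using top_monomial[OF assms(2)] by metis
  have only: "a = i \<and> b = j"
    if "b \<le> j + l" "a \<le> i + k" "mcoeff p a b * mcoeff q (i + k - a) (j + l - b) \<noteq> 0" for a b
  proof -
    from that(3) have nz: "mcoeff p a b \<noteq> 0" "mcoeff q (i + k - a) (j + l - b) \<noteq> 0" by auto
    note le = le_total_degree[OF nz(1)] le_total_degree[OF nz(2)]
    have 1: "a + b = total_degree p" using le that(1,2) p(2) q(2) by linarith
    have 2: "(i + k - a) + (j + l - b) = total_degree q"
      using le that(1,2) p(2) q(2) by linarith
    have "b \<le> j" using p(3)[OF nz(1) 1] .
    moreover have "j + l - b \<le> l" using q(3)[OF nz(2) 2] .
    ultimately have "b = j" by linarith
    then show ?thesis using 1 p(2) by simp
  qed
  have "mcoeff (p * q) (i + k) (j + l) =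
      (\<Sum>b\<le>j + l. \<Sum>a\<le>i + k. if a = i then if b = j then mcoeff p i j * mcoeff q k l else 0 else 0)"
    unfolding mcoeff_mult using only by (intro sum.cong refl) fastforce
  also have "\<dots> = mcoeff p i j * mcoeff q k l" by simp
  finally have "mcoeff (p * q) (i + k) (j + l) \<noteq> 0" using p(1) q(1) by simp
  then show "total_degree p + total_degree q \<le> total_degree (p * q)"
    using le_total_degree[of "p * q" "i + k" "j + l"] p(2) q(2) by simp
qed


section \<open>Rational functions in two variables\<close>

type_synonym 'k ratfun2 = "'k poly poly fract"

definition const2 :: "'k::field \<Rightarrow> 'k ratfun2" where "const2 c = to_fract (pconst c)"

text \<open>The total degree \<open>deg (a/b) = deg a - deg b\<close>, with the convention \<open>deg 0 = 0\<close>.\<close>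

definition ratfun_degree :: "'k::field ratfun2 \<Rightarrow> int"
  where "ratfun_degree r = (if r = 0 then 0 else
    (THE d. \<exists>a b. b \<noteq> 0 \<and> r = Fract a b \<and> d = int (total_degree a) - int (total_degree b)))"

lemma ratfun_degree_Fract:
  assumes "a \<noteq> 0" "b \<noteq> 0"
  shows "ratfun_degree (Fract a b) = int (total_degree a) - int (total_degree b)"
proof -
  have nz: "Fract a b \<noteq> 0" using assms by (simp add: Zero_fract_def eq_fract)
  have "d = int (total_degree a) - int (total_degree b)"
    if "b' \<noteq> 0" "Fract a b = Fract a' b'" "d = int (total_degree a') - int (total_degree b')"
    for d a' b'
  proof -
    have eq: "a * b' = a' * b" using that assms by (simp add: eq_fract)
    then have "a' \<noteq> 0" using assms that(1) by auto
    then show ?thesis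
      using eq total_degree_mult[of a b'] total_degree_mult[of a' b] assms that by simp
  qed
  then have "(THE d. \<exists>a' b'. b' \<noteq> 0 \<and> Fract a b = Fract a' b' \<and>
      d = int (total_degree a') - int (total_degree b')) =
      int (total_degree a) - int (total_degree b)"
    using assms(2) by (intro the_equality) metis+
  then show ?thesis unfolding ratfun_degree_def using nz by (simp only: if_False)
qed

text \<open>
  Partial derivatives: \<open>\<partial>/\<partial>x\<close> differentiates the coefficients, \<open>\<partial>/\<partial>y\<close> is the formal
  derivative with respect to the outer variable; both extend to fractions by the quotient rule.
\<close>

definition poly_dx :: "'k::field poly2 \<Rightarrow> 'k poly2" where "poly_dx p = map_poly pderiv p"

definition poly_dy :: "'k::field poly2 \<Rightarrow> 'k poly2" where "poly_dy p = pderiv p"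

lemma pderiv_sum: "pderiv (sum f A) = (\<Sum>i\<in>A. pderiv (f i))"
  by (induction A rule: infinite_finite_induct) (simp_all add: pderiv_add)

lemma poly_dx_mult: "poly_dx (p * q) = p * poly_dx q + q * poly_dx p"
proof (rule poly_eqI)
  fix n
  have "coeff (poly_dx (p * q)) n =
      (\<Sum>i\<le>n. coeff p i * pderiv (coeff q (n - i)) + coeff q (n - i) * pderiv (coeff p i))"
    by (simp add: poly_dx_def coeff_map_poly coeff_mult pderiv_sum pderiv_mult)
  also have "\<dots> = coeff (p * poly_dx q + poly_dx p * q) n"
    by (simp add: poly_dx_def coeff_map_poly coeff_mult sum.distrib mult.commute[of "coeff q _"])
  finally show "coeff (poly_dx (p * q)) n = coeff (p * poly_dx q + q * poly_dx p) n"
    by (simp add: mult.commute)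
qed

lemma poly_dy_mult: "poly_dy (p * q) = p * poly_dy q + q * poly_dy p"
  by (simp add: poly_dy_def pderiv_mult)

lemma quotient_rule_respects:
  fixes D :: "'a::idom \<Rightarrow> 'a"
  assumes D: "\<And>p q. D (p * q) = p * D q + q * D p"
    and eq: "a * d = c * b"
  shows "(D a * b - a * D b) * (d * d) = (D c * d - c * D d) * (b * b)"
proof -
  have "D (a * d) = D (c * b)" by (simp add: eq)
  then have "a * D d + d * D a = c * D b + b * D c" by (simp add: D)
  with eq show ?thesis by algebra
qed

lemma quotient_rule_unique:
  fixes D :: "'a::idom \<Rightarrow> 'a"
  assumes D: "\<And>p q. D (p * q) = p * D q + q * D p" and b: "b \<noteq> 0"
  shows "(THE s. \<exists>a' b'. b' \<noteq> 0 \<and> Fract a b = Fract a' b' \<and>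
      s = Fract (D a' * b' - a' * D b') (b' * b')) = Fract (D a * b - a * D b) (b * b)"
proof (rule the_equality)
  fix s
  assume "\<exists>a' b'. b' \<noteq> 0 \<and> Fract a b = Fract a' b' \<and> s = Fract (D a' * b' - a' * D b') (b' * b')"
  then obtain a' b' where *: "b' \<noteq> 0" "a * b' = a' * b"
    and s: "s = Fract (D a' * b' - a' * D b') (b' * b')"
    using b by (auto simp: eq_fract)
  show "s = Fract (D a * b - a * D b) (b * b)"
    using quotient_rule_respects[of D, OF D *(2)] b *(1) by (simp add: s eq_fract)
qed (use b in blast)

definition dx :: "'k::field ratfun2 \<Rightarrow> 'k ratfun2"
  where "dx r = (THE s. \<exists>a b. b \<noteq> 0 \<and> r = Fract a b \<and>
    s = Fract (poly_dx a * b - a * poly_dx b) (b * b))"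

definition dy :: "'k::field ratfun2 \<Rightarrow> 'k ratfun2"
  where "dy r = (THE s. \<exists>a b. b \<noteq> 0 \<and> r = Fract a b \<and>
    s = Fract (poly_dy a * b - a * poly_dy b) (b * b))"

lemma dx_Fract:
  "b \<noteq> 0 \<Longrightarrow> dx (Fract a b) = Fract (poly_dx a * b - a * poly_dx b) (b * b)"
  unfolding dx_def by (rule quotient_rule_unique[OF poly_dx_mult])

lemma dy_Fract:
  "b \<noteq> 0 \<Longrightarrow> dy (Fract a b) = Fract (poly_dy a * b - a * poly_dy b) (b * b)"
  unfolding dy_def by (rule quotient_rule_unique[OF poly_dy_mult])


section \<open>Poisson brackets\<close>

text \<open>
  The Poisson field \<open>K{f}\<close> is the field of rational functions together with the bracket
  \<open>poisson_bracket f\<close>.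
\<close>

definition poisson_bracket :: "'k::field poly2 \<Rightarrow> 'k ratfun2 \<Rightarrow> 'k ratfun2 \<Rightarrow> 'k ratfun2"
  where "poisson_bracket f g h = (dx g * dy h - dy g * dx h) * to_fract f"

lemma poly_dx_variables: "poly_dx PX = 1" "poly_dx PY = 0" "poly_dx 1 = 0"
  by (rule poly_eqI; simp add: poly_dx_def coeff_map_poly PX_def PY_def coeff_pCons pderiv_pCons
      split: nat.split)+

lemma poly_dy_variables: "poly_dy PX = 0" "poly_dy PY = 1" "poly_dy 1 = 0"
  by (simp_all add: poly_dy_def PX_def PY_def pderiv_pCons)

lemma dx_dy_variables:
  "dx (to_fract PX) = 1" "dy (to_fract PX) = 0" "dx (to_fract PY) = 0" "dy (to_fract PY) = 1"
  by (simp_all add: to_fract_def dx_Fract dy_Fract poly_dx_variables poly_dy_variables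
      One_fract_def Zero_fract_def)

lemma poisson_bracket_variables:
  "poisson_bracket f (to_fract PX) (to_fract PY) = to_fract f"
  by (simp add: poisson_bracket_def dx_dy_variables)

definition algebra_hom :: "('k::field ratfun2 \<Rightarrow> 'k ratfun2) \<Rightarrow> bool"
  where "algebra_hom \<phi> \<longleftrightarrow>
    (\<forall>c. \<phi> (const2 c) = const2 c) \<and>
    (\<forall>a b. \<phi> (a + b) = \<phi> a + \<phi> b) \<and>
    (\<forall>a b. \<phi> (a * b) = \<phi> a * \<phi> b)"

definition algebra_iso :: "('k::field ratfun2 \<Rightarrow> 'k ratfun2) \<Rightarrow> bool"
  where "algebra_iso \<phi> \<longleftrightarrow> algebra_hom \<phi> \<and> bij \<phi>"

definition poisson_morphism ::
    "'k::field poly2 \<Rightarrow> 'k poly2 \<Rightarrow> ('k ratfun2 \<Rightarrow> 'k ratfun2) \<Rightarrow> bool"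
  where "poisson_morphism f g \<phi> \<longleftrightarrow>
    algebra_hom \<phi> \<and>
    (\<forall>a b. \<phi> (poisson_bracket f a b) = poisson_bracket g (\<phi> a) (\<phi> b))"

definition poisson_automorphism :: "'k::field poly2 \<Rightarrow> ('k ratfun2 \<Rightarrow> 'k ratfun2) \<Rightarrow> bool"
  where "poisson_automorphism f \<phi> \<longleftrightarrow>
    poisson_morphism f f \<phi> \<and>
    (\<exists>\<psi>. poisson_morphism f f \<psi> \<and> \<psi> \<circ> \<phi> = id \<and> \<phi> \<circ> \<psi> = id)"

definition dixmier_property :: "'k::field poly2 \<Rightarrow> bool"
  where "dixmier_property f \<longleftrightarrow>
    (\<forall>\<phi>. poisson_morphism f f \<phi> \<longrightarrow> poisson_automorphism f \<phi>)"

end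

theory Submission
  imports Defs
begin

text \<open>
  Write \<open>\<phi>(x) = u/d\<close>, \<open>\<phi>(y) = v/d\<close> in lowest terms and \<open>\<phi>(l\<^sub>k) = N\<^sub>k/d\<close>. If a prime \<open>p\<close> divides
  \<open>d\<close>, then the \<open>N\<^sub>k\<close> divisible by \<open>p\<close> belong to parallel lines. Comparing the order at \<open>p\<close> of
  \<open>\<phi>(f) = \<Prod> \<phi>(l\<^sub>k)\<close> with that of \<open>\<phi>(f) = {\<phi>(x), \<phi>(y)}\<close>, a nonzero constant multiple of
  \<open>{\<phi>(l\<^sub>i), \<phi>(l\<^sub>j)}\<close>, for such an \<open>i\<close> of maximal order and a transversal \<open>j\<close> gives a contradiction,
  so \<open>\<phi>(x)\<close> and \<open>\<phi>(y)\<close> are polynomials. Then \<open>J g = \<Prod> \<phi>(l\<^sub>k)\<close> for the Jacobian determinant \<open>J\<close>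
  of \<open>\<phi>(x), \<phi>(y)\<close>, and \<open>deg J \<le> deg \<phi>(l\<^sub>i) + deg \<phi>(l\<^sub>j) - 2\<close> for all transversal \<open>i, j\<close>. Since
  no \<open>\<phi>(l\<^sub>k)\<close> is constant, \<open>deg g \<ge> m\<close>, and equality forces every \<open>\<phi>(l\<^sub>k)\<close> to be of degree one.
\<close>

section \<open>Irreducible elements of k[x,y] are prime\<close>

text \<open>Linear polynomials are prime in \<open>k[x]\<close>, and a prime stays prime as a
  constant of the polynomial ring in \<open>y\<close>. Over an algebraically closed field these are
  the factors that make up the content in \<open>k[x]\<close>.\<close>

lemma prime_elem_linear_const:
  "prime_elem [:[:a, 1:]:]" for a :: "'k::field"
  by (intro lift_prime_elem_poly field_poly_irreducible_imp_prime irreducible_linear_field_poly) simp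

text \<open>Factors \<open>x - z\<close> of \<open>c\<close> are removed one at a time. Each is
  prime and cannot divide \<open>p\<close>, which is irreducible of positive degree in
  \<open>y\<close>; hence it divides the cofactor and cancels.\<close>

lemma irreducible_dvd_smult_imp_dvd:
  fixes p a :: "'k::alg_closed_field poly2"
  assumes p: "irreducible p" "degree p > 0" and "c \<noteq> 0" "p dvd smult c a"
  shows "p dvd a"
  using assms(3,4)
proof (induction "degree c" arbitrary: c)
  case 0
  then obtain d where d: "c = [:d:]" "d \<noteq> 0" by (metis degree_eq_zeroE pCons_0_0)
  then have "a = smult [:inverse d:] (smult c a)" by (simp flip: one_pCons)
  with 0 show ?case by (metis dvd_smult)
next
  case (Suc n)
  have "\<exists>z. poly c z = 0" using Suc.hyps(2) by (intro alg_closed_imp_poly_has_root) simp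
  then obtain z c' where c: "c = [:-z, 1:] * c'" by (auto simp: poly_eq_0_iff_dvd elim: dvdE)
  have c': "c' \<noteq> 0" "n = degree c'"
    using Suc.prems Suc.hyps(2) unfolding c by (auto simp del: mult_pCons_left simp: degree_mult_eq)
  obtain h where h: "smult c a = p * h" using Suc.prems by (elim dvdE)
  let ?q = "[:[:-z, 1:]:]"
  have eq: "p * h = ?q * smult c' a" using h unfolding c by simp
  then have "?q dvd p \<or> ?q dvd h"
    using prime_elem_dvd_multD[OF prime_elem_linear_const] by (metis dvd_triv_left)
  moreover have "\<not> ?q dvd p"
  proof
    assume "?q dvd p"
    then obtain r where r: "p = ?q * r" by (elim dvdE)
    moreover have "\<not> ?q dvd 1" using prime_elem_linear_const by (rule prime_elem_not_unit)
    ultimately have "r dvd 1" using p(1) irreducibleD by blast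
    then have "degree r = 0" by (metis degree_1 dvd_imp_degree_le le_zero_eq one_neq_zero)
    with r have "degree p = 0" by (metis add_0 degree_mult_le degree_pCons_0 le_zero_eq)
    with p(2) show False by simp
  qed
  ultimately obtain h' where h': "h = ?q * h'" by (auto elim: dvdE)
  have "?q * (p * h') = ?q * smult c' a" using eq h' by (simp only: mult.left_commute)
  moreover have "?q \<noteq> 0" by simp
  ultimately have "p * h' = smult c' a" by (metis mult_left_cancel)
  then show ?case using Suc.hyps(1)[OF c'(2) c'(1)] by (metis dvd_triv_left)
qed

text \<open>Each prime factor \<open>x - z\<close> of \<open>c\<close> cancels against
  \<open>q\<close> or against \<open>r\<close>. Once \<open>c\<close> is constant, \<open>p\<close>
  is an associate of \<open>q * r\<close>; as \<open>r\<close> is not a unit, \<open>q\<close> is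
  one.\<close>

lemma irreducible_dvd_factor_upto_content:
  fixes p q r :: "'k::alg_closed_field poly2"
  assumes p: "irreducible p" and "c \<noteq> 0" "smult c p = q * r" "degree r > 0"
  shows "\<exists>e. e \<noteq> 0 \<and> p dvd smult e r"
  using assms(2-)
proof (induction "degree c" arbitrary: c q r)
  case 0
  then obtain d where d: "c = [:d:]" "d \<noteq> 0" by (metis degree_eq_zeroE pCons_0_0)
  then have "p = smult [:inverse d:] (smult c p)" by (simp flip: one_pCons)
  then have pe: "p = smult [:inverse d:] q * r" using 0 by simp
  moreover have "\<not> r dvd 1"
    using 0 by (metis degree_1 dvd_imp_degree_le le_zero_eq one_neq_zero less_numeral_extra(3))
  ultimately have "smult [:inverse d:] q dvd 1" using p irreducibleD by blast
  then have "p dvd r" unfolding pe by (metis dvd_refl mult_unit_dvd_iff mult.commute)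
  then show ?case by (intro exI[of _ 1]) simp
next
  case (Suc n)
  have "\<exists>z. poly c z = 0" using Suc.hyps(2) by (intro alg_closed_imp_poly_has_root) simp
  then obtain z c' where c: "c = [:-z, 1:] * c'" by (auto simp: poly_eq_0_iff_dvd elim: dvdE)
  have c': "c' \<noteq> 0" "n = degree c'"
    using Suc.prems Suc.hyps(2) unfolding c by (auto simp del: mult_pCons_left simp: degree_mult_eq)
  let ?q = "[:[:-z, 1:]:]"
  have nz: "?q \<noteq> 0" by simp
  have eq: "?q * smult c' p = q * r" using Suc.prems unfolding c by simp
  then have "?q dvd q \<or> ?q dvd r"
    using prime_elem_dvd_multD[OF prime_elem_linear_const] by (metis dvd_triv_left)
  then show ?case
  proof
    assume "?q dvd q"
    then obtain q' where "q = ?q * q'" by (elim dvdE)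
    with eq nz have "smult c' p = q' * r" by (metis mult_left_cancel mult.assoc)
    with Suc.hyps(1)[OF c'(2) c'(1)] Suc.prems show ?case by blast
  next
    assume "?q dvd r"
    then obtain r' where r': "r = ?q * r'" by (elim dvdE)
    with eq nz have "smult c' p = q * r'" by (metis mult_left_cancel mult.left_commute)
    moreover have "degree r' > 0" using Suc.prems(3) r' by (auto simp: degree_smult_eq)
    ultimately obtain e where "e \<noteq> 0" "p dvd smult e r'"
      using Suc.hyps(1)[OF c'(2) c'(1)] by blast
    moreover have "smult e r = ?q * smult e r'" using r' by simp
    ultimately show ?case by (metis dvd_mult)
  qed
qed

text \<open>Gauss's lemma by pseudo-division: an element of least \<open>y\<close>-degree of the ideal \<open>(p, a)\<close>
  divides \<open>p\<close> and \<open>a\<close> up to factors from \<open>k[x]\<close>.\<close>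

lemma irreducible_imp_prime_elem_poly2:
  fixes p :: "'k::alg_closed_field poly2"
  assumes p: "irreducible p"
  shows "prime_elem p"
proof (cases "degree p = 0")
  case True
  then obtain c where "p = [:c:]" by (elim degree_eq_zeroE)
  with p show ?thesis
    by (auto simp: irreducible_const_poly_iff intro!: lift_prime_elem_poly field_poly_irreducible_imp_prime)
next
  case False
  show ?thesis
  proof (rule prime_elemI)
    show "p \<noteq> 0" "\<not> p dvd 1" using p by (auto simp: irreducible_def)
    fix a b assume ab: "p dvd a * b"
    define I where "I = {s * p + t * a |s t. True}"
    have memI: "s * p + t * a \<in> I" for s t unfolding I_def by blast
    have "p \<in> I" "a \<in> I" using memI[of 1 0] memI[of 0 1] by auto
    then have "\<exists>r. r \<in> I \<and> r \<noteq> 0" using \<open>p \<noteq> 0\<close> by blast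
    then obtain r where r: "r \<in> I" "r \<noteq> 0" and min: "\<And>z. z \<in> I \<Longrightarrow> z \<noteq> 0 \<Longrightarrow> degree r \<le> degree z"
      using ex_has_least_nat[of "\<lambda>r. r \<in> I \<and> r \<noteq> 0" _ degree] by (metis (no_types, lifting))
    \<comment> \<open>Pseudo-division by \<open>r\<close> leaves a remainder in the ideal of smaller
      \<open>y\<close>-degree, which is zero by minimality of \<open>r\<close>. The factor
      \<open>c\<close> is a power of the leading coefficient of \<open>r\<close>.\<close>
    have div: "\<exists>c q. c \<noteq> 0 \<and> smult c z = q * r" if z: "z \<in> I" for z
    proof -
      obtain q s where qs: "pseudo_divmod z r = (q, s)" by fastforce
      let ?c = "coeff r (degree r) ^ (Suc (degree z) - degree r)"
      note pd = pseudo_divmod[OF r(2) qs]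
      have "s = [:?c:] * z - q * r" using pd(1) by simp
      moreover obtain s1 t1 s2 t2 where "z = s1 * p + t1 * a" "r = s2 * p + t2 * a"
        using z r(1) unfolding I_def by blast
      ultimately have "s = ([:?c:] * s1 - q * s2) * p + ([:?c:] * t1 - q * t2) * a"
        by (simp only: algebra_simps)
      then have "s \<in> I" using memI by simp
      then have "s = 0" using pd(2) min by fastforce
      then show ?thesis using pd(1) r(2) by (intro exI[of _ ?c] exI[of _ q]) (simp add: mult.commute)
    qed
    show "p dvd a \<or> p dvd b"
    proof (cases "degree r = 0")
      \<comment> \<open>Here \<open>r = e\<close> lies in \<open>k[x]\<close>. Multiplying
        \<open>r = s * p + t * a\<close> by \<open>b\<close> shows that \<open>p\<close> divides
        \<open>e * b\<close>.\<close>
      case True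
      then obtain e where e: "r = [:e:]" by (elim degree_eq_zeroE)
      obtain s t where "r = s * p + t * a" using r(1) unfolding I_def by blast
      moreover have "smult e b = r * b" by (simp add: e)
      ultimately have "smult e b = s * b * p + t * (a * b)" by (simp only: algebra_simps)
      then have "p dvd smult e b" using ab by simp
      then show ?thesis using irreducible_dvd_smult_imp_dvd[OF p _ , of e b] False r e by auto
    next
      \<comment> \<open>Up to factors from \<open>k[x]\<close>, \<open>r\<close> divides the
        irreducible \<open>p\<close>, so \<open>p\<close> divides \<open>r\<close>, which in turn
        divides \<open>a\<close>.\<close>
      case deg: False
      obtain c q where "c \<noteq> 0" "smult c p = q * r" using div \<open>p \<in> I\<close> by blast
      then obtain e where e: "e \<noteq> 0" "p dvd smult e r"
        using irreducible_dvd_factor_upto_content[OF p] deg by blast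
      obtain c' q' where c': "c' \<noteq> 0" "smult c' a = q' * r" using div \<open>a \<in> I\<close> by blast
      then have "smult (e * c') a = q' * smult e r" by (metis mult_smult_right smult_smult)
      then have "p dvd smult (e * c') a" using e(2) by (metis dvd_mult)
      then show ?thesis using irreducible_dvd_smult_imp_dvd[OF p] False e c' by (meson mult_eq_0_iff neq0_conv)
    qed
  qed
qed

section \<open>Total degree and derivations\<close>

lemma total_degree_leI:
  "(\<And>i j. mcoeff p i j \<noteq> 0 \<Longrightarrow> i + j \<le> n) \<Longrightarrow> total_degree p \<le> n"
  by (cases "p = 0") (simp add: total_degree_def mcoeff_def, metis total_degree_attained)

lemma mcoeff_add: "mcoeff (p + q) i j = mcoeff p i j + mcoeff q i j"
  and mcoeff_diff: "mcoeff (p - q) i j = mcoeff p i j - mcoeff q i j"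
  by (simp_all add: mcoeff_def)

lemma mcoeff_pconst: "mcoeff (pconst c) i j = (if i = 0 \<and> j = 0 then c else 0)"
  by (simp add: mcoeff_def pconst_def coeff_pCons split: nat.split)

lemma poly2_eqI: "(\<And>i j. mcoeff p i j = mcoeff q i j) \<Longrightarrow> p = q"
  by (simp add: mcoeff_def poly_eq_iff)

lemma total_degree_add_le:
  "total_degree p \<le> n \<Longrightarrow> total_degree q \<le> n \<Longrightarrow> total_degree (p + q) \<le> n"
  by (rule total_degree_leI) (metis add_0 le_total_degree le_trans mcoeff_add)

lemma total_degree_diff_le:
  "total_degree p \<le> n \<Longrightarrow> total_degree q \<le> n \<Longrightarrow> total_degree (p - q) \<le> n"
  by (rule total_degree_leI) (metis diff_0_right le_total_degree le_trans mcoeff_diff)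

lemma total_degree_0 [simp]: "total_degree 0 = 0"
  and total_degree_pconst [simp]: "total_degree (pconst c) = 0"
proof -
  show "total_degree 0 = 0" by (simp add: total_degree_def mcoeff_def)
  show "total_degree (pconst c) = 0"
    by (rule le_zero_eq[THEN iffD1], rule total_degree_leI) (simp add: mcoeff_pconst split: if_splits)
qed

lemma total_degree_sum_le:
  "(\<And>i. i \<in> A \<Longrightarrow> total_degree (s i) \<le> n) \<Longrightarrow> total_degree (\<Sum>i\<in>A. s i) \<le> n"
  by (induction A rule: infinite_finite_induct) (auto simp: total_degree_add_le)

lemma pconst_simps:
  "pconst 0 = 0" "pconst 1 = 1" "pconst (a + b) = pconst a + pconst b"
  "pconst (a - b) = pconst a - pconst b" "pconst (a * b) = pconst a * pconst b"
  by (simp_all add: pconst_def one_pCons)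

lemma pconst_eq_0_iff [simp]: "pconst a = 0 \<longleftrightarrow> a = 0"
  by (simp add: pconst_def)

lemma total_degree_1 [simp]: "total_degree 1 = 0"
  by (metis pconst_simps(2) total_degree_pconst)

lemma total_degree_mult_le:
  fixes p q :: "'k::idom poly2"
  shows "total_degree (p * q) \<le> total_degree p + total_degree q"
  by (cases "p = 0 \<or> q = 0") (auto simp: total_degree_mult)

lemma total_degree_power_le:
  fixes p :: "'k::idom poly2"
  shows "total_degree (p ^ n) \<le> n * total_degree p"
  by (induction n) (auto intro: order.trans[OF total_degree_mult_le])

lemma total_degree_prod:
  fixes s :: "'a \<Rightarrow> 'k::idom poly2"
  assumes "finite A" "\<And>i. i \<in> A \<Longrightarrow> s i \<noteq> 0"
  shows "total_degree (\<Prod>i\<in>A. s i) = (\<Sum>i\<in>A. total_degree (s i))"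
  using assms by (induction A rule: finite_induct) (auto simp: total_degree_mult)

lemma total_degree_eq_0D: "total_degree p = 0 \<Longrightarrow> p = pconst (mcoeff p 0 0)"
  by (rule poly2_eqI) (metis le_total_degree le_zero_eq mcoeff_pconst add_is_0)

lemma is_unit_poly2_iff:
  fixes p :: "'k::field poly2"
  shows "p dvd 1 \<longleftrightarrow> p \<noteq> 0 \<and> total_degree p = 0"
proof
  assume "p dvd 1"
  then obtain q where "1 = p * q" by (elim dvdE)
  then show "p \<noteq> 0 \<and> total_degree p = 0"
    using total_degree_mult[of p q] total_degree_1[where 'a = 'k]
    by (metis add_is_0 mult_zero_left mult_zero_right zero_neq_one)
next
  assume "p \<noteq> 0 \<and> total_degree p = 0"
  then obtain c where "p = pconst c" "c \<noteq> 0" by (metis pconst_simps(1) total_degree_eq_0D)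
  then have "1 = p * pconst (inverse c)" by (simp flip: pconst_simps)
  then show "p dvd 1" by (rule dvdI)
qed

lemma mcoeff_variables:
  "mcoeff PX i j = (if i = 1 \<and> j = 0 then 1 else 0)"
  "mcoeff PY i j = (if i = 0 \<and> j = 1 then 1 else 0)"
  by (auto simp: mcoeff_def PX_def PY_def coeff_pCons split: nat.split)

lemma mcoeff_pconst_mult: "mcoeff (pconst c * p) i j = c * mcoeff p i j"
  by (simp add: mcoeff_def pconst_def)

lemma mcoeff_affine_form:
  "mcoeff (affine_form a b c) i j =
    (if i = 1 \<and> j = 0 then a else if i = 0 \<and> j = 1 then b else if i = 0 \<and> j = 0 then c else 0)"
  by (simp add: affine_form_def mcoeff_add mcoeff_pconst_mult mcoeff_variables mcoeff_pconst)

lemma total_degree_affine_form_le: "total_degree (affine_form a b c) \<le> 1"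
  by (rule total_degree_leI) (simp add: mcoeff_affine_form split: if_splits)

lemma total_degree_affine_form:
  assumes "affine_form a b c \<notin> range pconst"
  shows "total_degree (affine_form a b c) = 1"
proof (rule antisym[OF total_degree_affine_form_le])
  show "1 \<le> total_degree (affine_form a b c)"
    using assms total_degree_eq_0D by (metis leI less_one rangeI)
qed

lemma total_degree_le_1D:
  assumes "total_degree p \<le> 1"
  shows "p = affine_form (mcoeff p 1 0) (mcoeff p 0 1) (mcoeff p 0 0)"
proof (rule poly2_eqI)
  fix i j
  show "mcoeff p i j = mcoeff (affine_form (mcoeff p 1 0) (mcoeff p 0 1) (mcoeff p 0 0)) i j"
  proof (cases "mcoeff p i j = 0")
    case False
    then have "i + j \<le> 1" using assms le_total_degree le_trans by blast
    then have "i = 0 \<and> j = 0 \<or> i = 1 \<and> j = 0 \<or> i = 0 \<and> j = 1" by linarith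
    then show ?thesis by (auto simp: mcoeff_affine_form)
  qed (auto simp: mcoeff_affine_form)
qed

lemma poly_dx_add: "poly_dx (p + q) = poly_dx p + poly_dx q"
  and poly_dx_pconst [simp]: "poly_dx (pconst c) = 0"
  by (auto simp: poly_eq_iff poly_dx_def coeff_map_poly pderiv_add pconst_def coeff_pCons pderiv_pCons
      split: nat.split)

lemma poly_dy_add: "poly_dy (p + q) = poly_dy p + poly_dy q"
  and poly_dy_pconst [simp]: "poly_dy (pconst c) = 0"
  by (simp_all add: poly_dy_def pderiv_add pconst_def pderiv_pCons)

lemmas poly_d_simps = poly_dx_add poly_dy_add poly_dx_mult poly_dy_mult

text \<open>A nonzero coefficient of a derivative comes from one of \<open>p\<close> of degree one
  higher. The premises exclude the zero derivative, whose degree is 0 by convention.\<close>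

lemma total_degree_derivative:
  "poly_dx p \<noteq> 0 \<Longrightarrow> total_degree (poly_dx p) + 1 \<le> total_degree p"
  "poly_dy p \<noteq> 0 \<Longrightarrow> total_degree (poly_dy p) + 1 \<le> total_degree p"
proof -
  assume "poly_dx p \<noteq> 0"
  then obtain i j where ij: "mcoeff (poly_dx p) i j \<noteq> 0" "i + j = total_degree (poly_dx p)"
    by (rule total_degree_attained)
  then have "mcoeff p (Suc i) j \<noteq> 0"
    by (auto simp: mcoeff_def poly_dx_def coeff_map_poly coeff_pderiv)
  with ij(2) show "total_degree (poly_dx p) + 1 \<le> total_degree p" using le_total_degree by fastforce
next
  assume "poly_dy p \<noteq> 0"
  then obtain i j where ij: "mcoeff (poly_dy p) i j \<noteq> 0" "i + j = total_degree (poly_dy p)"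
    by (rule total_degree_attained)
  then have "mcoeff p i (Suc j) \<noteq> 0"
    by (auto simp: mcoeff_def poly_dy_def coeff_pderiv of_nat_poly)
  with ij(2) show "total_degree (poly_dy p) + 1 \<le> total_degree p" using le_total_degree by fastforce
qed

definition jacobian :: "'k::field poly2 \<Rightarrow> 'k poly2 \<Rightarrow> 'k poly2"
  where "jacobian p q = poly_dx p * poly_dy q - poly_dy p * poly_dx q"

lemma total_degree_jacobian:
  assumes "jacobian p q \<noteq> 0"
  shows "total_degree (jacobian p q) + 2 \<le> total_degree p + total_degree q"
proof -
  \<comment> \<open>Subtraction on the naturals truncates, so \<open>prod'\<close> records
    separately that a nonzero product forces the degree sum to be at least 2.\<close>
  have prod: "total_degree (d * e) \<le> total_degree p + total_degree q - 2" (is ?P)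
    and prod': "d * e = 0 \<or> 2 \<le> total_degree p + total_degree q" (is ?Q)
    if "d \<noteq> 0 \<Longrightarrow> total_degree d + 1 \<le> total_degree p"
      "e \<noteq> 0 \<Longrightarrow> total_degree e + 1 \<le> total_degree q" for d e :: "'a poly2"
  proof -
    show ?P ?Q using that total_degree_mult[of d e] by (cases "d = 0 \<or> e = 0"; force)+
  qed
  have "2 \<le> total_degree p + total_degree q"
    using assms prod'[OF total_degree_derivative] prod'[OF total_degree_derivative(2,1)]
    unfolding jacobian_def by (metis diff_self)
  moreover have "total_degree (jacobian p q) \<le> total_degree p + total_degree q - 2"
    unfolding jacobian_def by (intro total_degree_diff_le prod total_degree_derivative)
  ultimately show ?thesis by linarith
qed

text \<open>Up to the factor \<open>d^3\<close> this is the Jacobian determinant of \<open>a/d\<close> and \<open>b/d\<close>; unlike that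
  determinant it is trilinear and alternating.\<close>

definition wronskian :: "'k::field poly2 \<Rightarrow> 'k poly2 \<Rightarrow> 'k poly2 \<Rightarrow> 'k poly2"
  where "wronskian d a b = d * jacobian a b + a * jacobian b d + b * jacobian d a"

text \<open>The form is alternating and trilinear over the constants, so terms containing
  \<open>d\<close> twice vanish and only a 2 by 2 determinant remains.\<close>

lemma wronskian_linear_forms:
  "wronskian d (pconst a1 * u + pconst b1 * v + pconst c1 * d)
      (pconst a2 * u + pconst b2 * v + pconst c2 * d) =
    pconst (a1 * b2 - b1 * a2) * wronskian d u v"
  unfolding wronskian_def jacobian_def by (simp add: poly_d_simps pconst_simps) algebra

text \<open>The quotient rule gives the denominator \<open>d ^ 4\<close>, but the numerator is
  \<open>d\<close> times the Wronskian, so one factor cancels.\<close>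

lemma poisson_bracket_Fract:
  assumes "d \<noteq> 0"
  shows "poisson_bracket g (Fract a d) (Fract b d) = Fract (wronskian d a b * g) (d ^ 3)"
proof -
  \<comment> \<open>The surplus factor \<open>d * d * (d * d)\<close> comes from subtracting two
    fractions by cross-multiplication without reducing.\<close>
  have "poisson_bracket g (Fract a d) (Fract b d) = Fract (((poly_dx a * d - a * poly_dx d) * (poly_dy b * d - b * poly_dy d) -
      (poly_dy a * d - a * poly_dy d) * (poly_dx b * d - b * poly_dx d)) * (d * d * (d * d)) * g)
      (d * d * (d * d) * (d * d * (d * d)))"
    using assms by (simp add: poisson_bracket_def dx_Fract dy_Fract to_fract_def algebra_simps)
  also have "\<dots> = Fract (wronskian d a b * g) (d ^ 3)"
    using assms by (simp add: eq_fract wronskian_def jacobian_def) algebra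
  finally show ?thesis .
qed

lemma poly_dx_power_Suc: "poly_dx (p ^ Suc n) = of_nat (Suc n) * p ^ n * poly_dx p"
  by (induction n) (simp_all add: poly_dx_mult algebra_simps)

lemma poly_dy_power_Suc: "poly_dy (p ^ Suc n) = of_nat (Suc n) * p ^ n * poly_dy p"
  by (induction n) (simp_all add: poly_dy_mult algebra_simps)

text \<open>A two-form \<open>dlog r \<and> dlog s\<close> has at most simple poles.\<close>

lemma power_dvd_wronskian:
  assumes "p ^ n dvd d" "p ^ e dvd a" "n \<ge> 1" "e \<ge> 1"
  shows "p ^ (n + e - 1) dvd wronskian d a b"
proof -
  obtain n' e' where ne: "n = Suc n'" "e = Suc e'" using assms(3,4) by (metis Suc_le_D One_nat_def)
  obtain d' a' where d: "d = p ^ Suc n' * d'" and a: "a = p ^ Suc e' * a'"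
    using assms(1,2) unfolding ne by (metis dvdE)
  define s t P P' :: "'a poly2" where "s = of_nat (Suc n')" "t = of_nat (Suc e')" "P = p ^ n'" "P' = p ^ e'"
  note st = this
  have dd: "d = P * p * d'" "poly_dx d = P * (p * poly_dx d' + s * d' * poly_dx p)"
    "poly_dy d = P * (p * poly_dy d' + s * d' * poly_dy p)"
    unfolding d poly_dx_mult poly_dy_mult poly_dx_power_Suc poly_dy_power_Suc st
    by (simp_all only: power_Suc algebra_simps)
  have aa: "a = P' * p * a'" "poly_dx a = P' * (p * poly_dx a' + t * a' * poly_dx p)"
    "poly_dy a = P' * (p * poly_dy a' + t * a' * poly_dy p)"
    unfolding a poly_dx_mult poly_dy_mult poly_dx_power_Suc poly_dy_power_Suc st
    by (simp_all only: power_Suc algebra_simps)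
  \<comment> \<open>Only \<open>jacobian d a\<close> differentiates both powers of \<open>p\<close>.
    Its one term without a further factor \<open>p\<close> is a multiple of
    \<open>jacobian p p = 0\<close>, which saves one power.\<close>
  have "wronskian d a b = P * P' * p * (
      d' * ((p * poly_dx a' + t * a' * poly_dx p) * poly_dy b - (p * poly_dy a' + t * a' * poly_dy p) * poly_dx b) +
      a' * (poly_dx b * (p * poly_dy d' + s * d' * poly_dy p) - poly_dy b * (p * poly_dx d' + s * d' * poly_dx p)) +
      b * (p * (poly_dx d' * poly_dy a' - poly_dy d' * poly_dx a') +
        t * a' * (poly_dx d' * poly_dy p - poly_dy d' * poly_dx p) +
        s * d' * (poly_dx p * poly_dy a' - poly_dy p * poly_dx a')))"
    unfolding wronskian_def jacobian_def dd(2,3) aa(2,3) unfolding dd(1) aa(1) by algebra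
  moreover have "P * P' * p = p ^ (n + e - 1)" unfolding ne st by (simp add: power_add algebra_simps)
  ultimately show ?thesis by simp
qed

section \<open>Absence of poles\<close>

text \<open>A divisor of least positive total degree is irreducible, since total degrees add under
  multiplication and units are the nonzero elements of degree 0.\<close>

lemma exists_irreducible_poly2_factor:
  fixes d :: "'k::field poly2"
  assumes "total_degree d > 0"
  obtains p where "irreducible p" "p dvd d"
proof -
  obtain p where p: "total_degree p > 0" "p dvd d"
    and min: "\<And>q. total_degree q > 0 \<Longrightarrow> q dvd d \<Longrightarrow> total_degree p \<le> total_degree q"
    using ex_has_least_nat[of "\<lambda>p. total_degree p > 0 \<and> p dvd d" d total_degree] assms by auto
  have "p \<noteq> 0" using p(1) by auto
  have "irreducible p"
  proof (rule irreducibleI)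
    show "p \<noteq> 0" "\<not> p dvd 1" using p(1) by (auto simp: is_unit_poly2_iff)
    fix a b assume ab: "p = a * b"
    then have "a \<noteq> 0" "b \<noteq> 0" using \<open>p \<noteq> 0\<close> by auto
    moreover have "total_degree a = 0 \<or> total_degree b = 0"
    proof (rule ccontr)
      assume *: "\<not> ?thesis"
      have "a dvd d" using ab p(2) by (metis dvd_mult_left)
      then have "total_degree p \<le> total_degree a" using min * by blast
      then show False using * ab total_degree_mult[OF calculation] by simp
    qed
    ultimately show "a dvd 1 \<or> b dvd 1" by (auto simp: is_unit_poly2_iff)
  qed
  with that p(2) show thesis by blast
qed

lemma power_multiplicity_poly2:
  fixes p q :: "'k::field poly2"
  assumes "\<not> p dvd 1" "q \<noteq> 0"
  obtains e r where "q = p ^ e * r" "\<not> p dvd r"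
  using assms(2)
proof (induction "total_degree q" arbitrary: q thesis rule: less_induct)
  case less
  show ?case
  proof (cases "p dvd q")
    case False
    with less.prems(1)[of 0 q] show ?thesis by simp
  next
    case True
    then obtain q' where q': "q = p * q'" by (elim dvdE)
    then have nz: "p \<noteq> 0" "q' \<noteq> 0" using less.prems by auto
    then have "total_degree p > 0" using assms(1) by (simp add: is_unit_poly2_iff)
    then have "total_degree q' < total_degree q" using q' nz by (simp add: total_degree_mult)
    then obtain e r where "q' = p ^ e * r" "\<not> p dvd r" using less.hyps nz by blast
    with q' less.prems(1)[of "Suc e" r] show ?thesis by (simp add: mult.assoc)
  qed
qed

lemma power_dvd_power_mult_iff:
  fixes p :: "'a::idom"
  assumes "\<not> p dvd r" "p \<noteq> 0" "p ^ n dvd p ^ e * r"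
  shows "n \<le> e"
proof (rule ccontr)
  assume "\<not> n \<le> e"
  then have "p ^ e * p dvd p ^ n" by (metis Suc_leI le_imp_power_dvd not_le power_Suc2)
  then have "p ^ e * p dvd p ^ e * r" using assms(3) dvd_trans by blast
  then show False using assms(1,2) by simp
qed

text \<open>The exponents of \<open>p\<close> in the factors divisible by \<open>p\<close> are at most the exponent \<open>n\<close> of \<open>p\<close>
  in \<open>d\<close>, with one possible exception \<open>i\<close>, because all these factors are parallel.\<close>

lemma no_common_pole:
  fixes p d u v g :: "'k::field poly2" and a b c :: "nat \<Rightarrow> 'k" and m :: nat
  defines "N \<equiv> \<lambda>k. pconst (a k) * u + pconst (b k) * v + pconst (c k) * d"
  assumes p: "prime_elem p" and pd: "p dvd d" and uv: "\<not> (p dvd u \<and> p dvd v)"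
    and d: "d \<noteq> 0" and N0: "\<And>k. k \<in> {1..m} \<Longrightarrow> N k \<noteq> 0" and m: "m \<ge> 4"
    and transversal: "\<And>i. i \<in> {1..m} \<Longrightarrow> card {j\<in>{1..m}. a i * b j - b i * a j \<noteq> 0} \<ge> 3"
    and parallel: "\<And>i k. i \<in> {1..m} \<Longrightarrow> k \<in> {1..m} \<Longrightarrow> i \<noteq> k \<Longrightarrow> a i * b k - b i * a k = 0 \<Longrightarrow>
      \<exists>t s. s \<noteq> 0 \<and> a k = t * a i \<and> b k = t * b i \<and> c k = t * c i + s"
    and eq: "d ^ (m - 3) * wronskian d u v * g = (\<Prod>k=1..m. N k)"
  shows False
proof -
  have pu: "\<not> p dvd 1" and p0: "p \<noteq> 0" using p by (auto simp: prime_elem_def)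
  have "\<exists>er. N k = p ^ fst er * snd er \<and> \<not> p dvd snd er" if "k \<in> {1..m}" for k
    using power_multiplicity_poly2[OF pu N0[OF that]] by (metis fst_conv snd_conv)
  then obtain er where er: "\<And>k. k \<in> {1..m} \<Longrightarrow> N k = p ^ fst (er k) * snd (er k) \<and> \<not> p dvd snd (er k)"
    by metis
  define e where "e k = fst (er k)" for k
  define r where "r k = snd (er k)" for k
  have Nk: "N k = p ^ e k * r k" and rk: "\<not> p dvd r k" if "k \<in> {1..m}" for k
    using er[OF that] by (auto simp: e_def r_def)
  obtain n d' where d': "d = p ^ n * d'" "\<not> p dvd d'" using power_multiplicity_poly2[OF pu d] .
  have n: "n \<ge> 1" using pd d' by (cases n) auto
  have p_prod: "\<not> p dvd (\<Prod>k\<in>A. r k)" if "A \<subseteq> {1..m}" for A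
    using finite_subset[OF that] that
    by (induction A rule: finite_induct) (use pu rk p in \<open>auto simp: prime_elem_dvd_mult_iff\<close>)
  have prod_N: "(\<Prod>k=1..m. N k) = p ^ (\<Sum>k=1..m. e k) * (\<Prod>k=1..m. r k)"
    by (simp add: Nk prod.distrib power_sum)
  define C where "C = {k\<in>{1..m}. e k > 0}"
  have finC: "finite C" "C \<subseteq> {1..m}" by (auto simp: C_def)
  have pN: "p dvd N k" if "k \<in> C" for k
    using that Nk[of k] by (auto simp: C_def intro: dvd_mult2 dvd_power)
  have sumC: "(\<Sum>k=1..m. e k) = (\<Sum>k\<in>C. e k)"
    by (rule sum.mono_neutral_right) (auto simp: C_def)
  have pcd: "p dvd pconst x * d" for x using pd by simp
  \<comment> \<open>By Cramer's rule, two numerators with nonzero determinant and divisible by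
    \<open>p\<close> would make \<open>p\<close> divide both \<open>u\<close> and
    \<open>v\<close>.\<close>
  have par: "a i * b k - b i * a k = 0" if "i \<in> C" "k \<in> C" for i k
  proof (rule ccontr)
    let ?t = "a i * b k - b i * a k"
    assume t: "?t \<noteq> 0"
    have 1: "p dvd pconst (a i) * u + pconst (b i) * v" "p dvd pconst (a k) * u + pconst (b k) * v"
      using pN[OF that(1)] pN[OF that(2)] pcd unfolding N_def by (metis dvd_add_left_iff)+
    have unit: "p dvd w" if "p dvd pconst ?t * w" for w
    proof -
      have "w = pconst (inverse ?t) * (pconst ?t * w)"
        using t by (simp add: mult.assoc[symmetric] flip: pconst_simps)
      then show ?thesis using that by (metis dvd_mult)
    qed
    have "pconst ?t * u = pconst (b k) * (pconst (a i) * u + pconst (b i) * v)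
        - pconst (b i) * (pconst (a k) * u + pconst (b k) * v)"
      by (simp add: pconst_simps algebra_simps)
    then have "p dvd u" using 1 unit by (metis dvd_diff dvd_mult)
    moreover have "pconst ?t * v = pconst (a i) * (pconst (a k) * u + pconst (b k) * v)
        - pconst (a k) * (pconst (a i) * u + pconst (b i) * v)"
      by (simp add: pconst_simps algebra_simps)
    then have "p dvd v" using 1 unit by (metis dvd_diff dvd_mult)
    ultimately show False using uv by blast
  qed
  \<comment> \<open>Since \<open>m - 3\<close> is positive, \<open>p\<close> divides the left side
    of \<open>eq\<close>, hence some numerator.\<close>
  have "C \<noteq> {}"
  proof
    assume "C = {}"
    then have "p ^ (\<Sum>k=1..m. e k) = 1" using sumC by simp
    then have "\<not> p dvd (\<Prod>k=1..m. N k)" using p_prod[of "{1..m}"] prod_N by simp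
    moreover obtain q where "m - 3 = Suc q" using m by (cases "m - 3") auto
    then have "p dvd d ^ (m - 3)" using pd by simp
    ultimately show False using eq by (metis dvd_mult2)
  qed
  then have "Max (e ` C) \<in> e ` C" using finC(1) by simp
  then obtain i where i: "i \<in> C" and "e i = Max (e ` C)" by auto
  then have imax: "\<And>k. k \<in> C \<Longrightarrow> e k \<le> e i" using finC(1) by simp
  have im: "i \<in> {1..m}" "e i \<ge> 1" using i by (auto simp: C_def)
  define S where "S = {j\<in>{1..m}. a i * b j - b i * a j \<noteq> 0}"
  \<comment> \<open>Lines in \<open>C\<close> are all parallel to line \<open>i\<close>, so its
    three transversals lie outside \<open>C\<close>; this gives
    \<open>card C + 3 \<le> m\<close>.\<close>
  have "C \<inter> S = {}" using par[OF i] by (auto simp: S_def)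
  moreover have "finite S" "S \<subseteq> {1..m}" by (auto simp: S_def)
  ultimately have "card C + card S \<le> card {1..m}"
    using finC by (metis card_Un_disjoint card_mono finite_atLeastAtMost Un_least)
  moreover have S3: "card S \<ge> 3" using transversal[OF im(1)] by (simp add: S_def)
  ultimately have cardC: "card C + 3 \<le> m" by simp
  \<comment> \<open>For parallel lines \<open>N k - pconst t * N i\<close> is a nonzero constant
    times \<open>d\<close>. As \<open>e k \<le> e i\<close>, the power \<open>p ^ e k\<close>
    divides this difference and hence \<open>d\<close>.\<close>
  have e_le: "e k \<le> n" if k: "k \<in> C - {i}" for k
  proof -
    obtain t s where ts: "s \<noteq> 0" "a k = t * a i" "b k = t * b i" "c k = t * c i + s"
      using parallel[of i k] par[OF i, of k] k im finC(2) by blast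
    then have "N k - pconst t * N i = pconst s * d"
      unfolding N_def by (simp add: pconst_simps algebra_simps)
    moreover have "p ^ e k dvd N k" "p ^ e k dvd N i"
      using Nk[of k] Nk[of i] im k finC(2) imax[of k] by (auto intro: dvd_mult2 le_imp_power_dvd)
    ultimately have "p ^ e k dvd pconst s * d" by (metis dvd_diff dvd_mult)
    then have "p ^ e k dvd pconst (inverse s) * (pconst s * d)" by (rule dvd_mult)
    moreover have "pconst (inverse s) * (pconst s * d) = d"
      using ts(1) by (simp add: mult.assoc[symmetric] flip: pconst_simps)
    ultimately have "p ^ e k dvd d" by (simp only:)
    then have "p ^ e k dvd p ^ n * d'" using d'(1) by (simp only:)
    then show ?thesis using power_dvd_power_mult_iff d'(2) p0 by blast
  qed
  have "(\<Sum>k\<in>C. e k) = e i + (\<Sum>k\<in>C - {i}. e k)" using finC i by (simp add: sum.remove)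
  also have "(\<Sum>k\<in>C - {i}. e k) \<le> n * (card C - 1)"
    using sum_bounded_above[of "C - {i}" e n] e_le finC i by (simp add: mult.commute)
  finally have upper: "(\<Sum>k\<in>C. e k) \<le> e i + n * (card C - 1)" by simp
  obtain j where j: "a i * b j - b i * a j \<noteq> 0" using S3 by (force simp: S_def)
  \<comment> \<open>Replacing \<open>u\<close>, \<open>v\<close> by \<open>N i\<close>,
    \<open>N j\<close> changes the Wronskian only by a nonzero constant, and brings in the high
    order of \<open>N i\<close> at \<open>p\<close>.\<close>
  have "p ^ (n + e i - 1) dvd wronskian d (N i) (N j)"
    using d' Nk[OF im(1)] n im by (intro power_dvd_wronskian) auto
  also have "wronskian d (N i) (N j) = pconst (a i * b j - b i * a j) * wronskian d u v"
    unfolding N_def by (rule wronskian_linear_forms)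
  finally have "p ^ (n + e i - 1) dvd pconst (inverse (a i * b j - b i * a j)) *
      (pconst (a i * b j - b i * a j) * wronskian d u v)" by (rule dvd_mult)
  then have "p ^ (n + e i - 1) dvd wronskian d u v"
    using j by (simp add: mult.assoc[symmetric] pconst_simps(2) flip: pconst_simps(5))
  moreover have "p ^ (n * (m - 3)) dvd d ^ (m - 3)"
    using d' by (simp add: power_mult power_mult_distrib)
  ultimately have "p ^ (n * (m - 3)) * p ^ (n + e i - 1) dvd d ^ (m - 3) * wronskian d u v * g"
    by (intro dvd_mult2 mult_dvd_mono)
  then have "p ^ (n * (m - 3) + (n + e i - 1)) dvd p ^ (\<Sum>k\<in>C. e k) * (\<Prod>k=1..m. r k)"
    using eq prod_N sumC by (simp add: power_add)
  then have "n * (m - 3) + (n + e i - 1) \<le> (\<Sum>k\<in>C. e k)"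
    using power_dvd_power_mult_iff p_prod[of "{1..m}"] p0 by blast
  \<comment> \<open>Together with \<open>card C \<le> m - 3\<close> this leaves
    \<open>2 * n \<le> 1\<close>, against \<open>n \<ge> 1\<close>.\<close>
  with upper have "n * (m - 3) + n + e i \<le> e i + n * (card C - 1) + 1" using n by linarith
  moreover have "n * (card C + 0) \<le> n * (m - 3)" using cardC by (intro mult_le_mono) auto
  moreover obtain q where "card C = Suc q" using \<open>C \<noteq> {}\<close> finC by (metis card_gt_0_iff gr0_implies_Suc)
  ultimately show False using n by simp
qed

section \<open>Algebra homomorphisms\<close>

lemma const2_simps:
  "const2 0 = 0" "const2 1 = 1" "const2 c = to_fract (pconst c)"
  by (simp_all add: const2_def pconst_simps)

lemma
  assumes "algebra_hom \<phi>"
  shows hom_const: "\<phi> (to_fract (pconst c)) = to_fract (pconst c)"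
    and hom_add: "\<phi> (r + s) = \<phi> r + \<phi> s"
    and hom_mult: "\<phi> (r * s) = \<phi> r * \<phi> s"
    and hom_0: "\<phi> 0 = 0"
    and hom_1: "\<phi> 1 = 1"
  using assms unfolding algebra_hom_def by (metis const2_simps)+

lemma hom_diff: "algebra_hom \<phi> \<Longrightarrow> \<phi> (r - s) = \<phi> r - \<phi> s"
  by (metis hom_add add_diff_cancel diff_add_cancel)

lemma hom_eq_0_iff:
  assumes "algebra_hom \<phi>"
  shows "\<phi> r = 0 \<longleftrightarrow> r = 0"
proof
  assume "\<phi> r = 0"
  then have "\<phi> (r * inverse r) = 0" using assms by (simp add: hom_mult)
  then show "r = 0" using hom_1[OF assms] by (metis right_inverse zero_neq_one)
qed (simp add: assms hom_0)

lemma hom_divide: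
  assumes "algebra_hom \<phi>"
  shows "\<phi> (r / s) = \<phi> r / \<phi> s"
proof (cases "s = 0")
  case False
  then have "\<phi> (r / s) * \<phi> s = \<phi> r" using hom_mult[OF assms, of "r / s" s] by simp
  then show ?thesis using False hom_eq_0_iff[OF assms] by (simp add: field_simps)
qed (simp add: hom_0[OF assms])

lemma hom_inj:
  assumes "algebra_hom \<phi>"
  shows "inj \<phi>"
proof (rule injI)
  fix r s assume "\<phi> r = \<phi> s"
  then have "\<phi> (r - s) = 0" using assms by (simp add: hom_diff)
  then show "r = s" using assms by (simp add: hom_eq_0_iff)
qed

lemma hom_power: "algebra_hom \<phi> \<Longrightarrow> \<phi> (r ^ n) = \<phi> r ^ n"
  by (induction n) (simp_all add: hom_1 hom_mult)

lemma hom_sum: "algebra_hom \<phi> \<Longrightarrow> \<phi> (\<Sum>i\<in>A. r i) = (\<Sum>i\<in>A. \<phi> (r i))"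
  by (induction A rule: infinite_finite_induct) (simp_all add: hom_0 hom_add)

lemma hom_prod: "algebra_hom \<phi> \<Longrightarrow> \<phi> (\<Prod>i\<in>A. r i) = (\<Prod>i\<in>A. \<phi> (r i))"
  by (induction A rule: infinite_finite_induct) (simp_all add: hom_1 hom_mult)

lemma to_fract_power: "to_fract (p ^ n) = to_fract p ^ n"
  by (induction n) simp_all

lemma to_fract_prod: "to_fract (\<Prod>i\<in>A. s i) = (\<Prod>i\<in>A. to_fract (s i))"
  by (induction A rule: infinite_finite_induct) simp_all

lemma hom_subst2:
  assumes "algebra_hom \<phi>" "\<phi> (to_fract u) = to_fract u'" "\<phi> (to_fract v) = to_fract v'"
  shows "\<phi> (to_fract (subst2 p u v)) = to_fract (subst2 p u' v')"
  using assms by (simp add: subst2_def hom_sum hom_mult hom_power hom_const to_fract_power)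

text \<open>This is the monomial expansion of \<open>p\<close>. Through it the images of
  \<open>PX\<close> and \<open>PY\<close> determine a homomorphism.\<close>

lemma subst2_variables: "subst2 p PX PY = p"
proof -
  have PX: "pconst a * PX ^ i = [:monom a i:]" for a :: 'a and i
    by (induction i) (simp_all add: pconst_def PX_def monom_0 monom_Suc mult.left_commute[of _ "[:[:0, 1:]:]"])
  have PY: "[:c:] * PY ^ j = monom c j" for c :: "'a poly" and j
    by (induction j) (simp_all add: PY_def monom_0 monom_Suc mult.left_commute[of _ "[:0, 1:]"])
  have const: "(\<Sum>i\<in>A. [:s i:]) = [:\<Sum>i\<in>A. s i:]" for s :: "nat \<Rightarrow> 'a poly" and A
    by (induction A rule: infinite_finite_induct) simp_all
  have "subst2 p PX PY = (\<Sum>j\<le>degree p. [:coeff p j:] * PY ^ j)"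
    unfolding subst2_def PX mcoeff_def sum_distrib_right[symmetric] const poly_as_sum_of_monoms ..
  then show ?thesis by (simp only: PY poly_as_sum_of_monoms)
qed

lemma hom_to_fract:
  assumes "algebra_hom \<phi>" "\<phi> (to_fract PX) = to_fract u" "\<phi> (to_fract PY) = to_fract v"
  shows "\<phi> (to_fract p) = to_fract (subst2 p u v)"
  using hom_subst2[OF assms, of p] by (simp add: subst2_variables)

text \<open>Each monomial of degree \<open>i + j\<close> becomes a product of \<open>i + j\<close>
  factors of degree at most 1. Used for an affine substitution and its inverse, this yields equality
  of degrees.\<close>

lemma total_degree_subst2_le:
  fixes u v :: "'k::idom poly2"
  assumes "total_degree u \<le> 1" "total_degree v \<le> 1"
  shows "total_degree (subst2 p u v) \<le> total_degree p"
  unfolding subst2_def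
proof (intro total_degree_sum_le)
  fix i j
  show "total_degree (pconst (mcoeff p i j) * u ^ i * v ^ j) \<le> total_degree p"
  proof (cases "mcoeff p i j = 0")
    case False
    have "total_degree (pconst (mcoeff p i j) * u ^ i * v ^ j) \<le>
        total_degree (pconst (mcoeff p i j)) + total_degree (u ^ i) + total_degree (v ^ j)"
      by (meson add_le_mono order.trans order_refl total_degree_mult_le)
    also have "\<dots> \<le> i * total_degree u + j * total_degree v"
      by (simp add: add_mono total_degree_power_le)
    also have "\<dots> \<le> i + j" using add_mono[OF mult_le_mono2[OF assms(1), of i] mult_le_mono2[OF assms(2), of j]] by (simp only: mult_1_right)
    also have "\<dots> \<le> total_degree p" using False by (rule le_total_degree)
    finally show ?thesis .
  qed (simp add: pconst_simps)
qed

lemma hom_affine_form: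
  assumes "algebra_hom \<phi>" "\<phi> (to_fract PX) = Fract u d" "\<phi> (to_fract PY) = Fract v d" "d \<noteq> 0"
  shows "\<phi> (to_fract (affine_form a b c)) = Fract (pconst a * u + pconst b * v + pconst c * d) d"
proof -
  have "\<phi> (to_fract (affine_form a b c)) =
      to_fract (pconst a) * Fract u d + to_fract (pconst b) * Fract v d + to_fract (pconst c)"
    using assms by (simp add: affine_form_def hom_add hom_mult hom_const)
  also have "\<dots> = Fract (pconst a * u + pconst b * v + pconst c * d) d"
    using assms(4) by (simp add: to_fract_def eq_fract algebra_simps)
  finally show ?thesis .
qed

lemma affine_form_variables: "PX = affine_form 1 0 0" "PY = affine_form 0 1 0"
  by (simp_all add: affine_form_def pconst_simps)

lemma inverse_hom:
  assumes "algebra_hom \<phi>" "bij \<phi>"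
  shows "algebra_hom (inv \<phi>)"
proof -
  have [simp]: "\<phi> (inv \<phi> r) = r" "inv \<phi> (\<phi> r) = r" for r
    using assms(2) by (simp_all add: bij_is_surj surj_f_inv_f bij_is_inj)
  have inv_eqI: "inv \<phi> r = s" if "r = \<phi> s" for r s using that by simp
  show ?thesis
    unfolding algebra_hom_def const2_def
    by (intro conjI allI inv_eqI) (simp_all add: hom_const hom_add hom_mult assms(1))
qed

section \<open>Homomorphisms given by an invertible affine substitution\<close>

context
  fixes \<phi> :: "'k::field ratfun2 \<Rightarrow> 'k ratfun2" and c11 c12 c21 c22 c1 c2 :: 'k
  assumes hom: "algebra_hom \<phi>" and det: "c11 * c22 - c12 * c21 \<noteq> 0"
    and X: "\<phi> (to_fract PX) = to_fract (affine_form c11 c12 c1)"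
    and Y: "\<phi> (to_fract PY) = to_fract (affine_form c21 c22 c2)"
begin

lemma affine_hom_preimages:
  obtains a b c a' b' c' where
    "\<phi> (to_fract (affine_form a b c)) = to_fract PX" "\<phi> (to_fract (affine_form a' b' c')) = to_fract PY"
proof -
  have *: "\<phi> (to_fract (affine_form a b c)) =
      to_fract (affine_form (a * c11 + b * c21) (a * c12 + b * c22) (a * c1 + b * c2 + c))" for a b c
    using hom_affine_form[OF hom, of "affine_form c11 c12 c1" 1 "affine_form c21 c22 c2"] X Y
    by (simp add: to_fract_def affine_form_def pconst_simps algebra_simps)
  define t where "t = c11 * c22 - c12 * c21"
  have t: "t \<noteq> 0" using det by (simp add: t_def)
  \<comment> \<open>The linear coefficients here and in the next claim are the two rows of the
    inverse matrix; the constant terms cancel the translation.\<close>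
  have "\<phi> (to_fract (affine_form (c22 / t) (- c12 / t) (- (c22 / t * c1 + - c12 / t * c2)))) = to_fract PX"
    using t unfolding * affine_form_variables by (simp add: field_simps) (simp add: t_def)
  moreover have "\<phi> (to_fract (affine_form (- c21 / t) (c11 / t) (- (- c21 / t * c1 + c11 / t * c2)))) = to_fract PY"
    using t unfolding * affine_form_variables by (simp add: field_simps) (simp add: t_def)
  ultimately show thesis using that by blast
qed

text \<open>The range contains both variables, hence every quotient of polynomials; injectivity
  holds for any homomorphism of fields.\<close>

lemma affine_hom_bij: "bij \<phi>"
proof -
  obtain u v where uv: "\<phi> (to_fract u) = to_fract PX" "\<phi> (to_fract v) = to_fract PY"
    using affine_hom_preimages by metis
  have "r \<in> range \<phi>" for r
  proof -
    obtain p q where "r = to_fract p / to_fract q" by (cases r) (auto simp: Fract_conv_to_fract)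
    then have "r = \<phi> (to_fract (subst2 p u v) / to_fract (subst2 q u v))"
      by (simp add: hom_divide hom hom_subst2[OF hom uv] subst2_variables)
    then show ?thesis by simp
  qed
  then show ?thesis using hom_inj[OF hom] by (auto simp: bij_def)
qed

text \<open>Neither the affine substitution nor its inverse raises the total degree of a polynomial,
  so both preserve it, and the claim passes to fractions.\<close>

lemma affine_hom_degree:
  assumes "r \<noteq> 0"
  shows "ratfun_degree (\<phi> r) = ratfun_degree r"
proof -
  let ?u = "affine_form c11 c12 c1" and ?v = "affine_form c21 c22 c2"
  obtain u v where uv: "\<phi> (to_fract u) = to_fract PX" "\<phi> (to_fract v) = to_fract PY"
    and deg: "total_degree u \<le> 1" "total_degree v \<le> 1"
    using affine_hom_preimages total_degree_affine_form_le by metis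
  have inv: "inv \<phi> (to_fract PX) = to_fract u" "inv \<phi> (to_fract PY) = to_fract v"
    using uv affine_hom_bij by (metis bij_inv_eq_iff)+
  have poly: "\<phi> (to_fract p) = to_fract (subst2 p ?u ?v)" for p
    using hom_to_fract[OF hom X Y] .
  \<comment> \<open>The inverse of \<open>\<phi>\<close> is the substitution of \<open>u\<close> and
    \<open>v\<close>, which have degree at most one.\<close>
  have "to_fract p = to_fract (subst2 (subst2 p ?u ?v) u v)" for p
    using hom_to_fract[OF inverse_hom[OF hom affine_hom_bij] inv, of "subst2 p ?u ?v"]
    unfolding poly[of p, symmetric] using bij_is_inj[OF affine_hom_bij] by simp
  then have subst_inv: "subst2 (subst2 p ?u ?v) u v = p" for p by simp
  have td: "total_degree (subst2 p ?u ?v) = total_degree p" for p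
    using total_degree_subst2_le[OF deg, of "subst2 p ?u ?v"] unfolding subst_inv
    by (intro order.antisym total_degree_subst2_le total_degree_affine_form_le)
  obtain a b where ab: "r = Fract a b" "a \<noteq> 0" "b \<noteq> 0"
    using assms by (cases r rule: Fract_cases_nonzero) auto
  have "\<phi> r = Fract (subst2 a ?u ?v) (subst2 b ?u ?v)"
    unfolding ab(1) Fract_conv_to_fract using hom_divide[OF hom] poly by simp
  moreover have "subst2 p ?u ?v \<noteq> 0" if "p \<noteq> 0" for p
    using poly[of p] hom_eq_0_iff[OF hom, of "to_fract p"] that by (metis to_fract_eq_0_iff)
  ultimately show ?thesis using ab by (simp add: ratfun_degree_Fract td)
qed

end

section \<open>Arrangements of lines\<close>

text \<open>If the determinant vanished, both forms would take the same values at the origin and at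
  some other point. So would every element of the subalgebra they generate, although
  \<open>PX\<close> and \<open>PY\<close> together separate points.\<close>

lemma generating_forms_det:
  assumes "generated_subalgebra {affine_form a b c, affine_form a' b' c'} = UNIV"
  shows "a * b' - b * a' \<noteq> (0::'k::field)"
proof
  assume det: "a * b' - b * a' = 0"
  define ev where "ev x y p = poly (poly p [:y:]) x" for x y :: 'k and p
  have ev_simps: "ev x y (p + q) = ev x y p + ev x y q" "ev x y (p * q) = ev x y p * ev x y q"
    "ev x y (pconst s) = s" "ev x y PX = x" "ev x y PY = y" for x y p q s
    by (simp_all add: ev_def pconst_def PX_def PY_def)
  have ev_affine: "ev x y (affine_form a b c) = a * x + b * y + c" for x y a b c
    by (simp add: affine_form_def ev_simps)
  have agree: "ev s s' p = ev 0 0 p"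
    if "p \<in> generated_subalgebra {affine_form a b c, affine_form a' b' c'}"
      "a * s + b * s' = 0" "a' * s + b' * s' = 0" for s s' p
    using that(1)
  proof (induction p rule: generated_subalgebra.induct)
    case (gen p)
    then consider "p = affine_form a b c" | "p = affine_form a' b' c'" by blast
    then show ?case by cases (simp_all only: ev_affine that(2,3) mult_zero_right add_0_left)
  qed (auto simp: ev_simps)
  have zero: "s = 0 \<and> s' = 0" if "a * s + b * s' = 0" "a' * s + b' * s' = 0" for s s'
    using agree[OF _ that, of PX] agree[OF _ that, of PY] assms by (simp only: ev_simps UNIV_I simp_thms)
  \<comment> \<open>A vanishing determinant makes \<open>(b, - a)\<close> a solution of both
    homogeneous equations. Once it is zero, \<open>(b', - a')\<close> is a solution, and finally so
    is \<open>(1, 1)\<close>.\<close>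
  have "a = 0 \<and> b = 0" using zero[of b "- a"] det by (simp add: algebra_simps)
  then have "a' = 0 \<and> b' = 0" using zero[of b' "- a'"] by simp
  with \<open>a = 0 \<and> b = 0\<close> show False using zero[of 1 1] by simp
qed

text \<open>The linear parts are proportional by some nonzero \<open>t\<close>. If \<open>c'\<close>
  were \<open>t * c\<close>, the forms themselves would be proportional, so
  \<open>s = c' - t * c\<close> is nonzero.\<close>

lemma parallel_forms:
  fixes a b c a' b' c' :: "'k::field"
  assumes "a * b' - b * a' = 0" "a \<noteq> 0 \<or> b \<noteq> 0" "a' \<noteq> 0 \<or> b' \<noteq> 0"
    and distinct: "\<not> (\<exists>s. s \<noteq> 0 \<and> affine_form a' b' c' = pconst s * affine_form a b c)"
  shows "\<exists>t s. s \<noteq> 0 \<and> a' = t * a \<and> b' = t * b \<and> c' = t * c + s"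
proof -
  obtain t where t: "a' = t * a" "b' = t * b"
  proof (cases "a = 0")
    case True
    then show thesis using assms that[of "b' / b"] by auto
  next
    case False
    then show thesis using assms that[of "a' / a"] by (auto simp: field_simps)
  qed
  then have "t \<noteq> 0" using assms(3) by auto
  have "affine_form a' b' (t * c) = pconst t * affine_form a b c"
    unfolding t affine_form_def by (simp add: pconst_simps algebra_simps)
  then have "c' \<noteq> t * c" using distinct \<open>t \<noteq> 0\<close> by blast
  then show ?thesis using t by (intro exI[of _ t] exI[of _ "c' - t * c"]) auto
qed

section \<open>Images of the generators\<close>

text \<open>Since \<open>f\<close> is the bracket of the variables, its image is both the product of
  the fractions \<open>N k / d\<close> and the bracket of \<open>u / d\<close> and
  \<open>v / d\<close>. Denominators are then cleared.\<close>

lemma poisson_image_equation: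
  fixes f g u v d :: "'k::field poly2" and a b c :: "nat \<Rightarrow> 'k"
  defines "N \<equiv> \<lambda>k. pconst (a k) * u + pconst (b k) * v + pconst (c k) * d"
  assumes morph: "poisson_morphism f g \<phi>" and f: "f = (\<Prod>k=1..m. affine_form (a k) (b k) (c k))"
    and d: "d \<noteq> 0" and X: "\<phi> (to_fract PX) = Fract u d" and Y: "\<phi> (to_fract PY) = Fract v d"
  shows "wronskian d u v * g * d ^ m = (\<Prod>k=1..m. N k) * d ^ 3"
proof -
  have hom: "algebra_hom \<phi>" using morph by (simp add: poisson_morphism_def)
  have Fract_prod: "(\<Prod>k\<in>A. Fract (N k) d) = Fract (\<Prod>k\<in>A. N k) (d ^ card A)" for A
    by (induction A rule: infinite_finite_induct) (simp_all add: One_fract_def)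
  have "\<phi> (to_fract f) = (\<Prod>k=1..m. \<phi> (to_fract (affine_form (a k) (b k) (c k))))"
    unfolding f to_fract_prod by (rule hom_prod[OF hom])
  also have "\<dots> = Fract (\<Prod>k=1..m. N k) (d ^ m)"
    using hom_affine_form[OF hom X Y d] Fract_prod[of "{1..m}"] by (simp add: N_def)
  finally have "\<phi> (to_fract f) = Fract (\<Prod>k=1..m. N k) (d ^ m)" .
  moreover have "\<phi> (to_fract f) = poisson_bracket g (Fract u d) (Fract v d)"
    using morph X Y by (metis poisson_bracket_variables poisson_morphism_def)
  ultimately show ?thesis using d by (simp add: poisson_bracket_Fract eq_fract)
qed

text \<open>The hypotheses on the lines in terms of coefficients: generating pairs have become
  nonzero determinants, and distinct parallel lines satisfy \<open>l_k = t * l_i + s\<close> with a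
  nonzero constant \<open>s\<close>.\<close>

locale line_arrangement =
  fixes m :: nat and a b c :: "nat \<Rightarrow> 'k::alg_closed_field"
  assumes m: "m \<ge> 1"
    and nonconst: "\<And>k. k \<in> {1..m} \<Longrightarrow> affine_form (a k) (b k) (c k) \<notin> range pconst"
    and transversal: "\<And>i. i \<in> {1..m} \<Longrightarrow> card {j\<in>{1..m}. a i * b j - b i * a j \<noteq> 0} \<ge> 3"
    and parallel: "\<And>i k. i \<in> {1..m} \<Longrightarrow> k \<in> {1..m} \<Longrightarrow> i \<noteq> k \<Longrightarrow> a i * b k - b i * a k = 0 \<Longrightarrow>
      \<exists>t s. s \<noteq> 0 \<and> a k = t * a i \<and> b k = t * b i \<and> c k = t * c i + s"
begin

text \<open>Three transversals do not fit into \<open>{k, i}\<close>. The free index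
  \<open>k\<close> is a line that the degree count needs to keep out of a transversal pair.\<close>

lemma transversal_exists:
  assumes "i \<in> {1..m}"
  obtains j where "j \<in> {1..m}" "j \<noteq> k" "j \<noteq> i" "a i * b j - b i * a j \<noteq> 0"
proof -
  let ?S = "{j\<in>{1..m}. a i * b j - b i * a j \<noteq> 0}"
  have "\<not> ?S \<subseteq> {k, i}"
  proof
    assume "?S \<subseteq> {k, i}"
    then have "card ?S \<le> card {k, i}" by (intro card_mono) auto
    also have "\<dots> \<le> 2" by (simp add: card_insert_if)
    finally show False using transversal[OF assms] by simp
  qed
  then show thesis using that by blast
qed

lemma four_le: "m \<ge> 4"
proof -
  have one: "1 \<in> {1..m}" using m by simp
  have "card {j\<in>{1..m}. a 1 * b j - b 1 * a j \<noteq> 0} \<le> card ({1..m} - {1})"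
    by (intro card_mono) auto
  then show ?thesis using transversal[OF one] one by simp
qed

context
  fixes f g :: "'k poly2" and \<phi> :: "'k ratfun2 \<Rightarrow> 'k ratfun2"
  assumes g0: "g \<noteq> 0" and morph: "poisson_morphism f g \<phi>"
    and f: "f = (\<Prod>k=1..m. affine_form (a k) (b k) (c k))"
begin

lemma hom: "algebra_hom \<phi>"
  using morph by (simp add: poisson_morphism_def)

text \<open>Among the common denominators of both images, one of least total degree is chosen. It
  must be constant, since an irreducible factor would be a prime pole, which
  \<open>no_common_pole\<close> excludes.\<close>

lemma images_polynomial:
  obtains u v where "\<phi> (to_fract PX) = to_fract u" "\<phi> (to_fract PY) = to_fract v"
proof -
  define rep where "rep = (\<lambda>(u, v, d). d \<noteq> 0 \<and> \<phi> (to_fract PX) = Fract u d \<and> \<phi> (to_fract PY) = Fract v d)"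
  obtain u1 d1 where 1: "\<phi> (to_fract PX) = Fract u1 d1" "d1 \<noteq> 0" by (cases "\<phi> (to_fract PX)") auto
  obtain v2 d2 where 2: "\<phi> (to_fract PY) = Fract v2 d2" "d2 \<noteq> 0" by (cases "\<phi> (to_fract PY)") auto
  have "rep (u1 * d2, v2 * d1, d1 * d2)" using 1 2 by (simp add: rep_def eq_fract)
  from ex_has_least_nat[of rep, OF this, of "\<lambda>(u, v, d). total_degree d"]
  obtain u v d where rep: "rep (u, v, d)"
    and min: "\<And>u' v' d'. rep (u', v', d') \<Longrightarrow> total_degree d \<le> total_degree d'" by auto
  have d: "d \<noteq> 0" and X: "\<phi> (to_fract PX) = Fract u d" and Y: "\<phi> (to_fract PY) = Fract v d"
    using rep by (simp_all add: rep_def)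
  have "total_degree d = 0"
  proof (rule ccontr)
    assume "total_degree d \<noteq> 0"
    then obtain p where irr: "irreducible p" and pd: "p dvd d"
      using exists_irreducible_poly2_factor by blast
    have p: "prime_elem p" using irr by (rule irreducible_imp_prime_elem_poly2)
    \<comment> \<open>A common factor could be cancelled from \<open>u\<close>, \<open>v\<close> and
      \<open>d\<close>, giving a denominator of smaller degree.\<close>
    have "\<not> (p dvd u \<and> p dvd v)"
    proof
      assume "p dvd u \<and> p dvd v"
      then obtain u' v' d' where eqs: "u = p * u'" "v = p * v'" "d = p * d'" using pd by (metis dvdE)
      have nz: "p \<noteq> 0" "d' \<noteq> 0" using eqs d by auto
      then have "rep (u', v', d')" using X Y eqs by (simp add: rep_def eq_fract)
      then have "total_degree d \<le> total_degree d'" by (rule min)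
      then show False using eqs nz irr is_unit_poly2_iff[of p]
        by (simp add: total_degree_mult irreducible_def)
    qed
    moreover have "pconst (a k) * u + pconst (b k) * v + pconst (c k) * d \<noteq> 0" if "k \<in> {1..m}" for k
    proof
      assume "pconst (a k) * u + pconst (b k) * v + pconst (c k) * d = 0"
      then have "\<phi> (to_fract (affine_form (a k) (b k) (c k))) = 0"
        using hom_affine_form[OF hom X Y d] d by (simp add: Zero_fract_def eq_fract)
      then have "affine_form (a k) (b k) (c k) = pconst 0"
        using hom_eq_0_iff[OF hom] by (simp add: pconst_simps)
      then show False using nonconst[OF that] by blast
    qed
    moreover have "d ^ (m - 3) * wronskian d u v * g =
      (\<Prod>k=1..m. pconst (a k) * u + pconst (b k) * v + pconst (c k) * d)" (is "?l = ?r")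
    proof -
      have "d ^ m = d ^ (m - 3) * d ^ 3" using four_le by (simp flip: power_add)
      then have "?l * d ^ 3 = ?r * d ^ 3"
        using poisson_image_equation[OF morph f d X Y] by (simp add: algebra_simps)
      then show ?thesis using d by simp
    qed
    ultimately show False
      using no_common_pole[OF p pd _ d _ four_le transversal parallel] by blast
  qed
  then obtain s where s: "d = pconst s" "s \<noteq> 0" using d by (metis pconst_simps(1) total_degree_eq_0D)
  have "Fract w d = to_fract (pconst (inverse s) * w)" for w
  proof -
    have "pconst (inverse s) * w * d = w"
      using s(2) unfolding s(1) by (simp add: mult.assoc mult.left_commute[of w] pconst_simps(2) flip: pconst_simps(5))
    then show ?thesis using d by (simp add: to_fract_def eq_fract)
  qed
  with X Y that show thesis by metis
qed

lemma total_degree_f: "total_degree f = m"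
proof -
  have "total_degree f = (\<Sum>k=1..m. total_degree (affine_form (a k) (b k) (c k)))"
    unfolding f using nonconst by (intro total_degree_prod) (auto, metis pconst_simps(1) rangeI)
  also have "\<dots> = (\<Sum>k=1..m. 1)" using nonconst by (intro sum.cong refl total_degree_affine_form)
  finally show ?thesis by simp
qed

text \<open>With polynomial images the denominator is 1 and the image equation reads
  \<open>J * g = (\<Prod>k=1..m. N k)\<close>. The first claim is this equation; the other two come
  from counting degrees in it.\<close>

lemma poisson_images:
  shows "\<exists>h. \<phi> (to_fract f) = to_fract (h * g)"
    and "total_degree f \<le> total_degree g"
    and "total_degree f = total_degree g \<Longrightarrow>
      \<exists>c11 c12 c21 c22 c1 c2. c11 * c22 - c12 * c21 \<noteq> 0 \<and>
        \<phi> (to_fract PX) = to_fract (affine_form c11 c12 c1) \<and>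
        \<phi> (to_fract PY) = to_fract (affine_form c21 c22 c2) \<and>
        \<phi> (to_fract f) = const2 (c11 * c22 - c12 * c21) * to_fract g"
proof -
  obtain u v where X: "\<phi> (to_fract PX) = to_fract u" and Y: "\<phi> (to_fract PY) = to_fract v"
    by (rule images_polynomial)
  have X': "\<phi> (to_fract PX) = Fract u 1" and Y': "\<phi> (to_fract PY) = Fract v 1"
    using X Y by (simp_all add: to_fract_def)
  define N where "N k = pconst (a k) * u + pconst (b k) * v + pconst (c k)" for k
  define J where "J = jacobian u v"
  have wronskian_1: "wronskian 1 p q = jacobian p q" for p q :: "'k poly2"
    by (simp add: wronskian_def jacobian_def poly_dx_variables poly_dy_variables)
  have JN: "J * g = (\<Prod>k=1..m. N k)"
    using poisson_image_equation[OF morph f _ X' Y'] by (simp add: wronskian_1 J_def N_def)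
  have phi_l: "\<phi> (to_fract (affine_form (a k) (b k) (c k))) = to_fract (N k)" for k
    using hom_affine_form[OF hom X' Y'] by (simp add: N_def to_fract_def)
  have phi_f: "\<phi> (to_fract f) = to_fract (J * g)"
    unfolding JN f to_fract_prod phi_l[symmetric] by (rule hom_prod[OF hom])
  then show "\<exists>h. \<phi> (to_fract f) = to_fract (h * g)" by blast
  \<comment> \<open>An injective \<open>\<phi>\<close> that fixes the constants cannot send a
    nonconstant line to a constant.\<close>
  have N1: "total_degree (N k) \<ge> 1" if "k \<in> {1..m}" for k
  proof (rule ccontr)
    assume "\<not> ?thesis"
    then obtain s where "N k = pconst s" using total_degree_eq_0D by (metis less_one not_le)
    then have "\<phi> (to_fract (affine_form (a k) (b k) (c k))) = \<phi> (to_fract (pconst s))"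
      unfolding phi_l hom_const[OF hom] by simp
    then have "affine_form (a k) (b k) (c k) = pconst s"
      using hom_inj[OF hom] by (metis injD to_fract_eq_iff)
    then show False using nonconst[OF that] by blast
  qed
  have N0: "N k \<noteq> 0" if "k \<in> {1..m}" for k using N1[OF that] by auto
  have J0: "J \<noteq> 0" using JN N0 by (metis finite_atLeastAtMost mult_zero_left prod_zero_iff)
  have jac: "jacobian (N i) (N j) = pconst (a i * b j - b i * a j) * J" for i j
    using wronskian_linear_forms[of 1 "a i" u "b i" v "c i" "a j" "b j" "c j"]
    by (simp add: wronskian_1 N_def J_def)
  have degs: "total_degree J + total_degree g = (\<Sum>k=1..m. total_degree (N k))"
    using total_degree_mult[OF J0 g0] JN total_degree_prod[of "{1..m}" N] N0 by simp
  \<comment> \<open>Up to a nonzero constant \<open>J\<close> is the Jacobian of \<open>N i\<close>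
    and \<open>N j\<close>, so its degree is at most the sum of theirs minus 2. This is subtracted
    from \<open>degs\<close>.\<close>
  have bound: "(\<Sum>k\<in>{1..m} - {i, j}. total_degree (N k)) + 2 \<le> total_degree g"
    if ij: "i \<in> {1..m}" "j \<in> {1..m}" "j \<noteq> i" "a i * b j - b i * a j \<noteq> 0" for i j
  proof -
    have "total_degree J + 2 \<le> total_degree (N i) + total_degree (N j)"
      using total_degree_jacobian[of "N i" "N j"] ij(4) J0 unfolding jac by (simp add: total_degree_mult)
    moreover have "(\<Sum>k=1..m. total_degree (N k)) =
        total_degree (N i) + (total_degree (N j) + (\<Sum>k\<in>{1..m} - {i} - {j}. total_degree (N k)))"
      using ij by (simp add: sum.remove[of _ i] sum.remove[of _ j])
    moreover have "{1..m} - {i} - {j} = {1..m} - {i, j}" by auto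
    ultimately show ?thesis using degs by simp
  qed
  have lower: "card A \<le> (\<Sum>k\<in>A. total_degree (N k))" if "A \<subseteq> {1..m}" for A
  proof -
    have "(\<Sum>k\<in>A. 1) \<le> (\<Sum>k\<in>A. total_degree (N k))" using N1 that by (intro sum_mono) blast
    then show ?thesis by simp
  qed
  have one: "1 \<in> {1..m}" using m by simp
  obtain j0 where j0: "j0 \<in> {1..m}" "j0 \<noteq> 1" "a 1 * b j0 - b 1 * a j0 \<noteq> 0"
    using transversal_exists[OF one] by metis
  have card2: "card ({1..m} - {i, j}) = m - 2" if "i \<in> {1..m}" "j \<in> {1..m}" "j \<noteq> i" for i j
    using that by (simp add: card_Diff_subset)
  \<comment> \<open>The \<open>m - 2\<close> factors outside a transversal pair have degree at least
    1 each.\<close>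
  have "m - 2 + 2 \<le> total_degree g"
    using bound[OF one j0] lower[of "{1..m} - {1, j0}"] card2[OF one j0(1,2)] by simp
  then show "total_degree f \<le> total_degree g" using total_degree_f four_le by simp
  assume "total_degree f = total_degree g"
  then have deg_g: "total_degree g = m" using total_degree_f by simp
  \<comment> \<open>For a transversal pair \<open>i\<close>, \<open>j\<close> avoiding
    \<open>k\<close>, the remaining \<open>m - 2\<close> factors have total degree at most
    \<open>m - 2\<close>. Each has degree at least 1, so \<open>N k\<close>, one of them, has degree
    exactly 1.\<close>
  have N_le: "total_degree (N k) \<le> 1" if k: "k \<in> {1..m}" for k
  proof -
    obtain i where i: "i \<in> {1..m}" "i \<noteq> k" "a k * b i - b k * a i \<noteq> 0"
      using transversal_exists[OF k] by metis
    obtain j where j: "j \<in> {1..m}" "j \<noteq> k" "j \<noteq> i" "a i * b j - b i * a j \<noteq> 0"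
      using transversal_exists[OF i(1)] by metis
    let ?A = "{1..m} - {i, j}"
    have "(\<Sum>k\<in>?A. total_degree (N k)) = total_degree (N k) + (\<Sum>k\<in>?A - {k}. total_degree (N k))"
      using k i(2) j(2) by (intro sum.remove) auto
    moreover have "card (?A - {k}) \<le> (\<Sum>k\<in>?A - {k}. total_degree (N k))" by (rule lower) auto
    moreover have "card (?A - {k}) = m - 3" using card2[OF i(1) j(1,3)] k i(2) j(2) by simp
    ultimately show ?thesis using bound[OF i(1) j(1,3,4)] deg_g four_le by linarith
  qed
  define t where "t = a 1 * b j0 - b 1 * a j0"
  have t: "t \<noteq> 0" using j0 by (simp add: t_def)
  have cancel: "w = pconst (inverse t) * (pconst t * w)" for w
    using t by (simp add: mult.assoc[symmetric] pconst_simps(2) flip: pconst_simps(5))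
  have lin: "total_degree (pconst s * w) \<le> 1" if "total_degree w \<le> 1" for s and w :: "'k poly2"
    using total_degree_mult_le[of "pconst s" w] that by simp
  have N': "total_degree (N k - pconst (c k)) \<le> 1" if "k \<in> {1..m}" for k
    using N_le[OF that] by (intro total_degree_diff_le) auto
  \<comment> \<open>Cramer's rule recovers \<open>u\<close> and \<open>v\<close> from the
    transversal pair \<open>1\<close>, \<open>j0\<close>, so both have degree at most one.\<close>
  have "pconst t * u = pconst (b j0) * (N 1 - pconst (c 1)) - pconst (b 1) * (N j0 - pconst (c j0))"
    "pconst t * v = pconst (a 1) * (N j0 - pconst (c j0)) - pconst (a j0) * (N 1 - pconst (c 1))"
    by (simp_all add: t_def N_def pconst_simps algebra_simps)
  then have "total_degree u \<le> 1" "total_degree v \<le> 1"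
    using cancel N'[OF one] N'[OF j0(1)] by (metis lin total_degree_diff_le)+
  then obtain c11 c12 c1 c21 c22 c2 where uv: "u = affine_form c11 c12 c1" "v = affine_form c21 c22 c2"
    using total_degree_le_1D by metis
  \<comment> \<open>The variables have Jacobian 1, so \<open>J\<close> is the determinant of the
    linear parts. That \<open>J\<close> is nonzero makes the matrix invertible.\<close>
  have J: "J = pconst (c11 * c22 - c12 * c21)"
    using wronskian_linear_forms[of 1 c11 PX c12 PY c1 c21 c22 c2]
    by (simp add: J_def uv affine_form_def wronskian_1)
      (simp add: jacobian_def poly_dx_variables poly_dy_variables)
  then show "\<exists>c11 c12 c21 c22 c1 c2. c11 * c22 - c12 * c21 \<noteq> 0 \<and>
        \<phi> (to_fract PX) = to_fract (affine_form c11 c12 c1) \<and>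
        \<phi> (to_fract PY) = to_fract (affine_form c21 c22 c2) \<and>
        \<phi> (to_fract f) = const2 (c11 * c22 - c12 * c21) * to_fract g"
    using J0 X Y phi_f unfolding uv by (metis const2_simps(3) pconst_eq_0_iff to_fract_mult)
qed

end

end

section \<open>Dixmier property, preservation of degree and homogeneity\<close>

lemma poisson_automorphismI:
  assumes "poisson_morphism f f \<phi>" "bij \<phi>"
  shows "poisson_automorphism f \<phi>"
proof -
  have [simp]: "\<phi> (inv \<phi> r) = r" "inv \<phi> (\<phi> r) = r" for r
    using assms(2) by (simp_all add: bij_is_surj surj_f_inv_f bij_is_inj)
  have "inv \<phi> (poisson_bracket f r s) = poisson_bracket f (inv \<phi> r) (inv \<phi> s)" for r s
  proof -
    have "\<phi> (poisson_bracket f (inv \<phi> r) (inv \<phi> s)) = poisson_bracket f r s"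
      using assms(1) by (simp add: poisson_morphism_def)
    then show ?thesis by (metis \<open>\<And>r. inv \<phi> (\<phi> r) = r\<close>)
  qed
  then have "poisson_morphism f f (inv \<phi>)"
    using assms(1) inverse_hom[OF _ assms(2)] by (simp add: poisson_morphism_def)
  moreover have "inv \<phi> \<circ> \<phi> = id" "\<phi> \<circ> inv \<phi> = id" by auto
  ultimately show ?thesis using assms(1) unfolding poisson_automorphism_def by blast
qed

theorem proposition6p3:
  fixes f g :: "'k::{alg_closed_field, field_char_0} poly2"
    and \<phi> :: "'k ratfun2 \<Rightarrow> 'k ratfun2"
    and l :: "nat \<Rightarrow> 'k poly2"
    and m :: nat
  assumes f_nonzero: "f \<noteq> 0"
    and g_nonzero: "g \<noteq> 0"
    and morphism: "poisson_morphism f g \<phi>"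
    and m_pos: "m \<ge> 1"
    and f_prod: "f = (\<Prod>i=1..m. l i)"
    and l_form: "\<forall>i\<in>{1..m}. (\<exists>a b c. l i = affine_form a b c) \<and> l i \<notin> range pconst"
    and l_distinct: "\<forall>i\<in>{1..m}. \<forall>j\<in>{1..m}. i \<noteq> j \<longrightarrow> \<not> (\<exists>c. c \<noteq> 0 \<and> l i = pconst c * l j)"
    and l_generate: "\<forall>i\<in>{1..m}. card {j\<in>{1..m}. generated_subalgebra {l i, l j} = UNIV} \<ge> 3"
  shows
    "((\<exists>h. \<phi> (to_fract f) = to_fract (h * g)) \<and> total_degree f \<le> total_degree g) \<and>
     (total_degree f = total_degree g \<longrightarrow>
        (\<forall>r. r \<noteq> 0 \<longrightarrow> ratfun_degree (\<phi> r) = ratfun_degree r) \<and>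
        algebra_iso \<phi> \<and>
        (\<exists>c11 c12 c21 c22 c1 c2.
           c11 * c22 - c12 * c21 \<noteq> 0 \<and>
           \<phi> (to_fract PX) = to_fract (affine_form c11 c12 c1) \<and>
           \<phi> (to_fract PY) = to_fract (affine_form c21 c22 c2) \<and>
           \<phi> (to_fract f) = const2 (c11 * c22 - c12 * c21) * to_fract g)) \<and>
     (homogeneous f \<and> total_degree f = total_degree g \<longrightarrow>
        (\<exists>u v. affine_coordinates u v \<and>
           (\<exists>P Q G. homogeneous_of_degree 1 P \<and> homogeneous_of_degree 1 Q \<and> homogeneous G \<and>
              \<phi> (to_fract PX) = to_fract (subst2 P u v) \<and>
              \<phi> (to_fract PY) = to_fract (subst2 Q u v) \<and>
              g = subst2 G u v))) \<and>
     dixmier_property f"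
proof -
  have "\<forall>i\<in>{1..m}. \<exists>a b c. l i = affine_form a b c" using l_form by blast
  then obtain a b c where l: "\<And>i. i \<in> {1..m} \<Longrightarrow> l i = affine_form (a i) (b i) (c i)" by metis
  have f: "f = (\<Prod>k=1..m. affine_form (a k) (b k) (c k))"
    unfolding f_prod by (intro prod.cong refl l)
  have nonconst: "affine_form (a k) (b k) (c k) \<notin> range pconst" if "k \<in> {1..m}" for k
    using l_form l[OF that] that by metis
  have direction: "a k \<noteq> 0 \<or> b k \<noteq> 0" if "k \<in> {1..m}" for k
    using nonconst[OF that] by (auto simp: affine_form_def pconst_simps)
  have transversal: "card {j\<in>{1..m}. a i * b j - b i * a j \<noteq> 0} \<ge> 3" if i: "i \<in> {1..m}" for i
  proof -
    have "{j\<in>{1..m}. generated_subalgebra {l i, l j} = UNIV} \<subseteq> {j\<in>{1..m}. a i * b j - b i * a j \<noteq> 0}"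
    proof
      fix j assume "j \<in> {j\<in>{1..m}. generated_subalgebra {l i, l j} = UNIV}"
      then have j: "j \<in> {1..m}" and gen: "generated_subalgebra {l i, l j} = UNIV" by auto
      show "j \<in> {j\<in>{1..m}. a i * b j - b i * a j \<noteq> 0}"
        using generating_forms_det[OF gen[unfolded l[OF i] l[OF j]]] j by simp
    qed
    then have "card {j\<in>{1..m}. generated_subalgebra {l i, l j} = UNIV} \<le>
        card {j\<in>{1..m}. a i * b j - b i * a j \<noteq> 0}" by (intro card_mono) auto
    with l_generate i show ?thesis by (meson order.trans)
  qed
  have parallel: "\<exists>t s. s \<noteq> 0 \<and> a k = t * a i \<and> b k = t * b i \<and> c k = t * c i + s"
    if "i \<in> {1..m}" "k \<in> {1..m}" "i \<noteq> k" "a i * b k - b i * a k = 0" for i k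
    using parallel_forms[OF that(4) direction[OF that(1)] direction[OF that(2)]] l_distinct l that by metis
  interpret line_arrangement m a b c
    using m_pos nonconst transversal parallel by unfold_locales
  note * = poisson_images[OF g_nonzero morphism f]
  have hom: "algebra_hom \<phi>" using morphism by (simp add: poisson_morphism_def)
  have "dixmier_property f"
    unfolding dixmier_property_def
  proof (intro allI impI)
    fix \<psi> assume \<psi>: "poisson_morphism f f \<psi>"
    then have "algebra_hom \<psi>" by (simp add: poisson_morphism_def)
    \<comment> \<open>With \<open>f\<close> also as the target the degrees agree by reflexivity, so
      every endomorphism is an invertible affine substitution.\<close>
    then have "bij \<psi>" using poisson_images(3)[OF f_nonzero \<psi> f refl] affine_hom_bij by blast
    with \<psi> show "poisson_automorphism f \<psi>" by (rule poisson_automorphismI)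
  qed
  moreover have "(\<forall>r. r \<noteq> 0 \<longrightarrow> ratfun_degree (\<phi> r) = ratfun_degree r) \<and> algebra_iso \<phi>"
    if "total_degree f = total_degree g"
    using *(3)[OF that] affine_hom_bij[OF hom] affine_hom_degree[OF hom] hom
    unfolding algebra_iso_def by blast
  moreover have "\<exists>u v. affine_coordinates u v \<and>
           (\<exists>P Q G. homogeneous_of_degree 1 P \<and> homogeneous_of_degree 1 Q \<and> homogeneous G \<and>
              \<phi> (to_fract PX) = to_fract (subst2 P u v) \<and>
              \<phi> (to_fract PY) = to_fract (subst2 Q u v) \<and>
              g = subst2 G u v)"
    if hf: "homogeneous f" "total_degree f = total_degree g"
  proof -
    obtain c11 c12 c21 c22 c1 c2 where det: "c11 * c22 - c12 * c21 \<noteq> 0"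
      and X: "\<phi> (to_fract PX) = to_fract (affine_form c11 c12 c1)"
      and Y: "\<phi> (to_fract PY) = to_fract (affine_form c21 c22 c2)"
      and F: "\<phi> (to_fract f) = const2 (c11 * c22 - c12 * c21) * to_fract g"
      using *(3)[OF hf(2)] by blast
    \<comment> \<open>The new variables are the images of \<open>PX\<close> and \<open>PY\<close>,
      so \<open>P\<close> and \<open>Q\<close> are the variables themselves. Since substituting them
      in \<open>f\<close> gives \<open>?t\<close> times \<open>g\<close>, the polynomial
      \<open>G\<close> is \<open>f\<close> divided by \<open>?t\<close>.\<close>
    let ?u = "affine_form c11 c12 c1" and ?v = "affine_form c21 c22 c2"
    let ?t = "c11 * c22 - c12 * c21"
    let ?G = "pconst (inverse ?t) * f"
    have "affine_coordinates ?u ?v" using det unfolding affine_coordinates_def by blast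
    moreover have "homogeneous_of_degree 1 (PX :: 'k poly2)" "homogeneous_of_degree 1 (PY :: 'k poly2)"
      by (auto simp: homogeneous_of_degree_def mcoeff_variables split: if_splits)
    moreover have "homogeneous ?G"
      using hf(1) by (auto simp: homogeneous_def homogeneous_of_degree_def mcoeff_pconst_mult)
    moreover have "\<phi> (to_fract PX) = to_fract (subst2 PX ?u ?v)" "\<phi> (to_fract PY) = to_fract (subst2 PY ?u ?v)"
      by (rule hom_to_fract[OF hom X Y])+
    moreover have "g = subst2 ?G ?u ?v"
    proof -
      have "to_fract (subst2 ?G ?u ?v) = \<phi> (to_fract ?G)" by (rule hom_to_fract[OF hom X Y, symmetric])
      also have "\<dots> = to_fract (pconst (inverse ?t) * (pconst ?t * g))"
        using F by (simp add: hom_mult[OF hom] hom_const[OF hom] const2_def)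
      also have "pconst (inverse ?t) * (pconst ?t * g) = g"
        using det by (simp add: mult.assoc[symmetric] pconst_simps(2) flip: pconst_simps(5))
      finally show ?thesis by simp
    qed
    ultimately show ?thesis by blast
  qed
  ultimately show ?thesis using * by blast
qed

end
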